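(* There are no almost cosymplectic generalized $(\kappa,\mu,\nu)$-space forms $M(f_1,\ldots,f_8)$ of dimension greater than or equal to $5$ with $\kappa=f_1-f_3<0$.
   Context: Manifolds, tensor fields and functions are smooth. An almost contact metric manifold $(M,\phi,\xi,\eta,g)$ is an odd-dimensional Riemannian manifold $(M,g)$ with a $(1,1)$-tensor field $\phi$, a vector field $\xi$ and a 1-form $\eta$ such that $\eta(\xi)=1$, $\phi^2X=-X+\eta(X)\xi$ and $g(\phi X,\phi Y)=g(X,Y)-\eta(X)\eta(Y)$. Its fundamental 2-form is $\Phi(X,Y)=g(X,\phi Y)$. It is almost cosymplectic if $d\eta=0$ and $d\Phi=0$. Put $h=\frac12L_\xi\phi$ ($L$ the Lie derivative) and $R(X,Y)Z=\nabla_X\nabla_YZ-\nabla_Y\nabla_XZ-\nabla_{[X,Y]}Z$, with $\nabla$ the Levi-Civita connection. A generalized $(\kappa,\mu,\nu)$-space form, denoted $M(f_1,\ldots,f_8)$, is an almost contact metric manifold whose curvature tensor can be written as $R=f_1R_1+f_2R_2+f_3R_3+f_4R_4+f_5R_5+f_6R_6+f_7R_7+f_8R_8$ with $f_1,\ldots,f_8$ functions on $M$, where for all vector fields $X,Y,Z$: $R_1(X,Y)Z=g(Y,Z)X-g(X,Z)Y$; $R_2(X,Y)Z=g(X,\phi Z)\phi Y-g(Y,\phi Z)\phi X+2g(X,\phi Y)\phi Z$; $R_3(X,Y)Z=\eta(X)\eta(Z)Y-\eta(Y)\eta(Z)X+g(X,Z)\eta(Y)\xi-g(Y,Z)\eta(X)\xi$;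 $R_4(X,Y)Z=g(Y,Z)hX-g(X,Z)hY+g(hY,Z)X-g(hX,Z)Y$; $R_5(X,Y)Z=g(hY,Z)hX-g(hX,Z)hY+g(\phi hX,Z)\phi hY-g(\phi hY,Z)\phi hX$; $R_6(X,Y)Z=\eta(X)\eta(Z)hY-\eta(Y)\eta(Z)hX+g(hX,Z)\eta(Y)\xi-g(hY,Z)\eta(X)\xi$; $R_7(X,Y)Z=g(Y,Z)\phi hX-g(X,Z)\phi hY+g(\phi hY,Z)X-g(\phi hX,Z)Y$; $R_8(X,Y)Z=\eta(X)\eta(Z)\phi hY-\eta(Y)\eta(Z)\phi hX+g(\phi hX,Z)\eta(Y)\xi-g(\phi hY,Z)\eta(X)\xi$. *)

theory Defs
  imports "HOL-Analysis.Analysis" "HOL-Library.Function_Algebras"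
begin

(* Pointwise real vector space structure on functions; it serves tangent vectors (functionals on
   functions) as well as vector fields (families of tangent vectors). *)

instantiation "fun" :: (type, real_vector) real_vector
begin

definition scaleR_fun :: "real \<Rightarrow> ('a \<Rightarrow> 'b) \<Rightarrow> 'a \<Rightarrow> 'b"
  where "scaleR_fun r f = (\<lambda>x. r *\<^sub>R f x)"

instance
  by standard (auto simp: scaleR_fun_def fun_eq_iff algebra_simps)

end

section \<open>Smooth manifolds\<close>

primrec times_differentiable_on ::
  "nat \<Rightarrow> 'e::euclidean_space set \<Rightarrow> ('e \<Rightarrow> 'b::real_normed_vector) \<Rightarrow> bool" where
  "times_differentiable_on 0 S f \<longleftrightarrow> continuous_on S f"
| "times_differentiable_on (Suc k) S f \<longleftrightarrow>
     (\<forall>x\<in>S. f differentiable (at x)) \<and>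
     (\<forall>v. times_differentiable_on k S (\<lambda>x. frechet_derivative f (at x) v))"

(* Only used for open S. *)
definition smooth_on ::
  "'e::euclidean_space set \<Rightarrow> ('e \<Rightarrow> 'b::real_normed_vector) \<Rightarrow> bool" where
  "smooth_on S f \<longleftrightarrow> (\<forall>k. times_differentiable_on k S f)"

type_synonym ('a, 'e) atlas = "('a set \<times> ('a \<Rightarrow> 'e)) set"
type_synonym 'a tangent = "('a \<Rightarrow> real) \<Rightarrow> real"
type_synonym 'a field = "'a \<Rightarrow> 'a tangent"

(* The manifold is the set topspace T; its dimension is DIM('e). The atlas need not be maximal:
   every atlas determines a unique smooth structure. Boundary is excluded since chart images are
   open. *)
locale smooth_manifold =
  fixes T :: "'a topology" and A :: "('a, 'e::euclidean_space) atlas"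
  assumes Hausdorff: "Hausdorff_space T"
    and second_countable: "second_countable T"
    and chart_domain_open: "\<And>U c. (U, c) \<in> A \<Longrightarrow> openin T U"
    and chart_image_open: "\<And>U c. (U, c) \<in> A \<Longrightarrow> open (c ` U)"
    and chart_homeomorphic: "\<And>U c. (U, c) \<in> A \<Longrightarrow>
          homeomorphic_map (subtopology T U) (top_of_set (c ` U)) c"
    and charts_cover: "\<Union> (fst ` A) = topspace T"
    and charts_compatible: "\<And>U c V d. (U, c) \<in> A \<Longrightarrow> (V, d) \<in> A \<Longrightarrow>
          smooth_on (c ` (U \<inter> V)) (d \<circ> inv_into U c)"
begin

abbreviation M :: "'a set" where "M \<equiv> topspace T"

(* Values outside M are irrelevant. *)
definition smooth_fun :: "('a \<Rightarrow> real) \<Rightarrow> bool" where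
  "smooth_fun f \<longleftrightarrow> (\<forall>(U, c) \<in> A. smooth_on (c ` U) (f \<circ> inv_into U c))"

(* Derivations at p of the algebra of smooth functions on M, extended by 0 to the remaining
   functions so that equality of tangent vectors is equality of derivations. No condition for the
   values of f outside M is needed: if f vanishes on M then f = f * k, where k is the (smooth)
   function that is 0 on M and 1 elsewhere, and so v f = f p * v k + k p * v f = 0. *)
definition tangent_space :: "'a \<Rightarrow> 'a tangent set" where
  "tangent_space p = {v.
     (\<forall>f g a b. smooth_fun f \<longrightarrow> smooth_fun g \<longrightarrow>
        v (\<lambda>q. a * f q + b * g q) = a * v f + b * v g) \<and>
     (\<forall>f g. smooth_fun f \<longrightarrow> smooth_fun g \<longrightarrow> v (\<lambda>q. f q * g q) = f p * v g + g p * v f) \<and>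
     (\<forall>f. \<not> smooth_fun f \<longrightarrow> v f = 0)}"

end

(* The function X(f). *)
definition act :: "'a field \<Rightarrow> ('a \<Rightarrow> real) \<Rightarrow> 'a \<Rightarrow> real" where
  "act X f = (\<lambda>p. X p f)"

(* [X,Y] f = X(Y f) - Y(X f). For a non-smooth f both terms are 0 on M, so that [X,Y] p is again a
   tangent vector in the sense above. *)
definition bracket :: "'a field \<Rightarrow> 'a field \<Rightarrow> 'a field" where
  "bracket X Y = (\<lambda>p f. X p (act Y f) - Y p (act X f))"

definition fmult :: "('a \<Rightarrow> real) \<Rightarrow> 'a field \<Rightarrow> 'a field" (infixr "*\<^sub>F" 75) where
  "f *\<^sub>F X = (\<lambda>p. f p *\<^sub>R X p)"

(* Values of tensor fields on vector fields. *)

definition ap1 :: "('a \<Rightarrow> 'a tangent \<Rightarrow> 'b) \<Rightarrow> 'a field \<Rightarrow> 'a \<Rightarrow> 'b" where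
  "ap1 t X = (\<lambda>p. t p (X p))"

definition ap2 :: "('a \<Rightarrow> 'a tangent \<Rightarrow> 'a tangent \<Rightarrow> 'b) \<Rightarrow> 'a field \<Rightarrow> 'a field \<Rightarrow> 'a \<Rightarrow> 'b" where
  "ap2 t X Y = (\<lambda>p. t p (X p) (Y p))"

(* Exterior derivatives of a 1-form and of a 2-form, without the factors 1/2 and 1/3 of the other
   common convention. *)

definition ext_deriv1 :: "('a \<Rightarrow> 'a tangent \<Rightarrow> real) \<Rightarrow> 'a field \<Rightarrow> 'a field \<Rightarrow> 'a \<Rightarrow> real" where
  "ext_deriv1 w X Y = act X (ap1 w Y) - act Y (ap1 w X) - ap1 w (bracket X Y)"

definition ext_deriv2 ::
  "('a \<Rightarrow> 'a tangent \<Rightarrow> 'a tangent \<Rightarrow> real) \<Rightarrow> 'a field \<Rightarrow> 'a field \<Rightarrow> 'a field \<Rightarrow> 'a \<Rightarrow> real" where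
  "ext_deriv2 w X Y Z =
     act X (ap2 w Y Z) + act Y (ap2 w Z X) + act Z (ap2 w X Y)
     - ap2 w (bracket X Y) Z - ap2 w (bracket Y Z) X - ap2 w (bracket Z X) Y"

(* (L_X t) Y for a (1,1)-tensor field t. *)
definition lie_deriv11 ::
  "'a field \<Rightarrow> ('a \<Rightarrow> 'a tangent \<Rightarrow> 'a tangent) \<Rightarrow> 'a field \<Rightarrow> 'a field" where
  "lie_deriv11 X t Y = bracket X (ap1 t Y) - ap1 t (bracket X Y)"

context smooth_manifold
begin

definition vector_field :: "'a field \<Rightarrow> bool" where
  "vector_field X \<longleftrightarrow>
     (\<forall>p\<in>M. X p \<in> tangent_space p) \<and> (\<forall>f. smooth_fun f \<longrightarrow> smooth_fun (act X f))"

definition one_form :: "('a \<Rightarrow> 'a tangent \<Rightarrow> real) \<Rightarrow> bool" where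
  "one_form w \<longleftrightarrow>
     (\<forall>p\<in>M. \<forall>u\<in>tangent_space p. \<forall>v\<in>tangent_space p. \<forall>a b.
        w p (a *\<^sub>R u + b *\<^sub>R v) = a * w p u + b * w p v) \<and>
     (\<forall>X. vector_field X \<longrightarrow> smooth_fun (ap1 w X))"

definition tensor11_field :: "('a \<Rightarrow> 'a tangent \<Rightarrow> 'a tangent) \<Rightarrow> bool" where
  "tensor11_field t \<longleftrightarrow>
     (\<forall>p\<in>M. \<forall>u\<in>tangent_space p. t p u \<in> tangent_space p) \<and>
     (\<forall>p\<in>M. \<forall>u\<in>tangent_space p. \<forall>v\<in>tangent_space p. \<forall>a b.
        t p (a *\<^sub>R u + b *\<^sub>R v) = a *\<^sub>R t p u + b *\<^sub>R t p v) \<and>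
     (\<forall>X. vector_field X \<longrightarrow> vector_field (ap1 t X))"

definition riemannian_metric :: "('a \<Rightarrow> 'a tangent \<Rightarrow> 'a tangent \<Rightarrow> real) \<Rightarrow> bool" where
  "riemannian_metric g \<longleftrightarrow>
     (\<forall>p\<in>M. \<forall>u\<in>tangent_space p. \<forall>v\<in>tangent_space p. \<forall>w\<in>tangent_space p. \<forall>a b.
        g p (a *\<^sub>R u + b *\<^sub>R v) w = a * g p u w + b * g p v w) \<and>
     (\<forall>p\<in>M. \<forall>u\<in>tangent_space p. \<forall>v\<in>tangent_space p. g p u v = g p v u) \<and>
     (\<forall>p\<in>M. \<forall>u\<in>tangent_space p. u \<noteq> 0 \<longrightarrow> 0 < g p u u) \<and>
     (\<forall>X Y. vector_field X \<longrightarrow> vector_field Y \<longrightarrow> smooth_fun (ap2 g X Y))"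

definition affine_connection :: "('a field \<Rightarrow> 'a field \<Rightarrow> 'a field) \<Rightarrow> bool" where
  "affine_connection nabla \<longleftrightarrow>
     (\<forall>X Y. vector_field X \<longrightarrow> vector_field Y \<longrightarrow> vector_field (nabla X Y)) \<and>
     (\<forall>X Y Z. vector_field X \<longrightarrow> vector_field Y \<longrightarrow> vector_field Z \<longrightarrow>
        (\<forall>p\<in>M. nabla (X + Y) Z p = (nabla X Z + nabla Y Z) p \<and>
               nabla X (Y + Z) p = (nabla X Y + nabla X Z) p)) \<and>
     (\<forall>f X Y. smooth_fun f \<longrightarrow> vector_field X \<longrightarrow> vector_field Y \<longrightarrow>
        (\<forall>p\<in>M. nabla (f *\<^sub>F X) Y p = (f *\<^sub>F nabla X Y) p \<and>
               nabla X (f *\<^sub>F Y) p = (act X f *\<^sub>F Y + f *\<^sub>F nabla X Y) p))"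

definition levi_civita ::
  "('a \<Rightarrow> 'a tangent \<Rightarrow> 'a tangent \<Rightarrow> real) \<Rightarrow> ('a field \<Rightarrow> 'a field \<Rightarrow> 'a field) \<Rightarrow> bool" where
  "levi_civita g nabla \<longleftrightarrow>
     affine_connection nabla \<and>
     (\<forall>X Y. vector_field X \<longrightarrow> vector_field Y \<longrightarrow>
        (\<forall>p\<in>M. (nabla X Y - nabla Y X) p = bracket X Y p)) \<and>
     (\<forall>X Y Z. vector_field X \<longrightarrow> vector_field Y \<longrightarrow> vector_field Z \<longrightarrow>
        (\<forall>p\<in>M. act X (ap2 g Y Z) p = (ap2 g (nabla X Y) Z + ap2 g Y (nabla X Z)) p))"

end

definition curvature ::
  "('a field \<Rightarrow> 'a field \<Rightarrow> 'a field) \<Rightarrow> 'a field \<Rightarrow> 'a field \<Rightarrow> 'a field \<Rightarrow> 'a field" where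
  "curvature nabla X Y Z =
     nabla X (nabla Y Z) - nabla Y (nabla X Z) - nabla (bracket X Y) Z"

section \<open>Almost contact metric manifolds\<close>

locale almost_contact_metric_manifold = smooth_manifold T A
  for T :: "'a topology" and A :: "('a, 'e::euclidean_space) atlas" +
  fixes \<phi> :: "'a \<Rightarrow> 'a tangent \<Rightarrow> 'a tangent"
    and \<xi> :: "'a field"
    and \<eta> :: "'a \<Rightarrow> 'a tangent \<Rightarrow> real"
    and g :: "'a \<Rightarrow> 'a tangent \<Rightarrow> 'a tangent \<Rightarrow> real"
  assumes odd_dim: "odd DIM('e)"
    and phi_tensor: "tensor11_field \<phi>"
    and xi_field: "vector_field \<xi>"
    and eta_form: "one_form \<eta>"
    and metric: "riemannian_metric g"
    and eta_xi: "\<And>p. p \<in> M \<Longrightarrow> \<eta> p (\<xi> p) = 1"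
    and phi_phi: "\<And>p u. p \<in> M \<Longrightarrow> u \<in> tangent_space p \<Longrightarrow>
          \<phi> p (\<phi> p u) = - u + \<eta> p u *\<^sub>R \<xi> p"
    and phi_metric: "\<And>p u v. p \<in> M \<Longrightarrow> u \<in> tangent_space p \<Longrightarrow> v \<in> tangent_space p \<Longrightarrow>
          g p (\<phi> p u) (\<phi> p v) = g p u v - \<eta> p u * \<eta> p v"
begin

definition fundamental_form :: "'a \<Rightarrow> 'a tangent \<Rightarrow> 'a tangent \<Rightarrow> real" where
  "fundamental_form p u v = g p u (\<phi> p v)"

definition h :: "'a field \<Rightarrow> 'a field" where
  "h X = (1/2) *\<^sub>R lie_deriv11 \<xi> \<phi> X"

abbreviation ph :: "'a field \<Rightarrow> 'a field" where "ph X \<equiv> ap1 \<phi> X"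
abbreviation et :: "'a field \<Rightarrow> 'a \<Rightarrow> real" where "et X \<equiv> ap1 \<eta> X"
abbreviation gg :: "'a field \<Rightarrow> 'a field \<Rightarrow> 'a \<Rightarrow> real" where "gg X Y \<equiv> ap2 g X Y"

definition R1 :: "'a field \<Rightarrow> 'a field \<Rightarrow> 'a field \<Rightarrow> 'a field" where
  "R1 X Y Z = gg Y Z *\<^sub>F X - gg X Z *\<^sub>F Y"

definition R2 :: "'a field \<Rightarrow> 'a field \<Rightarrow> 'a field \<Rightarrow> 'a field" where
  "R2 X Y Z = gg X (ph Z) *\<^sub>F ph Y - gg Y (ph Z) *\<^sub>F ph X + 2 *\<^sub>R (gg X (ph Y) *\<^sub>F ph Z)"

definition R3 :: "'a field \<Rightarrow> 'a field \<Rightarrow> 'a field \<Rightarrow> 'a field" where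
  "R3 X Y Z = (et X * et Z) *\<^sub>F Y - (et Y * et Z) *\<^sub>F X
     + (gg X Z * et Y) *\<^sub>F \<xi> - (gg Y Z * et X) *\<^sub>F \<xi>"

definition R4 :: "'a field \<Rightarrow> 'a field \<Rightarrow> 'a field \<Rightarrow> 'a field" where
  "R4 X Y Z = gg Y Z *\<^sub>F h X - gg X Z *\<^sub>F h Y + gg (h Y) Z *\<^sub>F X - gg (h X) Z *\<^sub>F Y"

definition R5 :: "'a field \<Rightarrow> 'a field \<Rightarrow> 'a field \<Rightarrow> 'a field" where
  "R5 X Y Z = gg (h Y) Z *\<^sub>F h X - gg (h X) Z *\<^sub>F h Y
     + gg (ph (h X)) Z *\<^sub>F ph (h Y) - gg (ph (h Y)) Z *\<^sub>F ph (h X)"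

definition R6 :: "'a field \<Rightarrow> 'a field \<Rightarrow> 'a field \<Rightarrow> 'a field" where
  "R6 X Y Z = (et X * et Z) *\<^sub>F h Y - (et Y * et Z) *\<^sub>F h X
     + (gg (h X) Z * et Y) *\<^sub>F \<xi> - (gg (h Y) Z * et X) *\<^sub>F \<xi>"

definition R7 :: "'a field \<Rightarrow> 'a field \<Rightarrow> 'a field \<Rightarrow> 'a field" where
  "R7 X Y Z = gg Y Z *\<^sub>F ph (h X) - gg X Z *\<^sub>F ph (h Y)
     + gg (ph (h Y)) Z *\<^sub>F X - gg (ph (h X)) Z *\<^sub>F Y"

definition R8 :: "'a field \<Rightarrow> 'a field \<Rightarrow> 'a field \<Rightarrow> 'a field" where
  "R8 X Y Z = (et X * et Z) *\<^sub>F ph (h Y) - (et Y * et Z) *\<^sub>F ph (h X)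
     + (gg (ph (h X)) Z * et Y) *\<^sub>F \<xi> - (gg (ph (h Y)) Z * et X) *\<^sub>F \<xi>"

end

locale almost_cosymplectic_manifold = almost_contact_metric_manifold T A \<phi> \<xi> \<eta> g
  for T :: "'a topology" and A :: "('a, 'e::euclidean_space) atlas" and \<phi> \<xi> \<eta> g +
  assumes d_eta: "\<And>X Y p. vector_field X \<Longrightarrow> vector_field Y \<Longrightarrow> p \<in> M \<Longrightarrow>
          ext_deriv1 \<eta> X Y p = 0"
    and d_Phi: "\<And>X Y Z p. vector_field X \<Longrightarrow> vector_field Y \<Longrightarrow> vector_field Z \<Longrightarrow> p \<in> M \<Longrightarrow>
          ext_deriv2 fundamental_form X Y Z p = 0"

(* The generalized (kappa,mu,nu)-space form M(f1,...,f8). The Levi-Civita connection is unique on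
   vector fields up to irrelevant values outside M, whence the existential quantifier. *)
locale generalized_space_form = almost_contact_metric_manifold T A \<phi> \<xi> \<eta> g
  for T :: "'a topology" and A :: "('a, 'e::euclidean_space) atlas" and \<phi> \<xi> \<eta> g +
  fixes f1 f2 f3 f4 f5 f6 f7 f8 :: "'a \<Rightarrow> real"
  assumes coefficients_smooth: "\<forall>f \<in> {f1, f2, f3, f4, f5, f6, f7, f8}. smooth_fun f"
    and curvature_form: "\<exists>nabla. levi_civita g nabla \<and>
          (\<forall>X Y Z. vector_field X \<longrightarrow> vector_field Y \<longrightarrow> vector_field Z \<longrightarrow>
             (\<forall>p\<in>M. curvature nabla X Y Z p =
               (f1 *\<^sub>F R1 X Y Z + f2 *\<^sub>F R2 X Y Z + f3 *\<^sub>F R3 X Y Z + f4 *\<^sub>F R4 X Y Z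
              + f5 *\<^sub>F R5 X Y Z + f6 *\<^sub>F R6 X Y Z + f7 *\<^sub>F R7 X Y Z + f8 *\<^sub>F R8 X Y Z) p))"

end

theory Submission
  imports Defs
begin

text \<open>
  Let \<open>S = - \<nabla>\<xi>\<close>, the shape operator of the leaves of the foliation \<open>\<eta> = 0\<close>. Closedness of \<open>\<eta>\<close> makes
  \<open>S\<close> symmetric, and closedness of the fundamental form makes it anticommute with \<open>\<phi>\<close> (\<open>shape_ph\<close>); moreover
  \<open>h = - \<phi> S\<close> and \<open>\<phi> h = S\<close>, so that the curvature of the space form is expressed by \<open>g\<close>, \<open>\<phi>\<close> and \<open>S\<close>.

  The values \<open>R(X,\<xi>)\<xi>\<close> give \<open>S\<^sup>2 = - \<kappa>\<close> on the leaves. For \<open>\<kappa> < 0\<close> the leaves therefore carry two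
  eigendistributions \<open>V\<close> and \<open>V'\<close>, for the eigenvalues \<open>\<plusminus> lam\<close> with \<open>lam = sqrt (- \<kappa>)\<close>, and \<open>\<phi>\<close> interchanges
  them; in dimension at least 5 both have rank at least 2. The values \<open>R(X,Y)\<xi> = 0\<close> for \<open>X\<close>, \<open>Y\<close> tangent to
  the leaves are the Codazzi equation for \<open>S\<close>. A Codazzi tensor with two eigenvalues of multiplicity at
  least 2 and constant square has parallel eigendistributions (\<open>nabla_eigen_parallel\<close>), where the
  constancy of \<open>lam\<close> along the leaves comes from the multiplicity (\<open>act_lam_eigen\<close>). Then the leaves, being almost
  Kaehler with an anti-invariant parallel splitting, have parallel \<open>\<phi>\<close> (\<open>nabla_ph\<close>).

  Hence the curvature of a leaf preserves \<open>V\<close> and \<open>V'\<close> and commutes with \<open>\<phi>\<close>; by the Gauss equation these are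
  linear conditions on \<open>R\<close> (\<open>curvature_opposite\<close> and \<open>curvature_ph\<close>). Put in the space form and take orthogonal
  vectors \<open>x\<close>, \<open>y\<close> of \<open>V\<close>. The first condition forces \<open>f\<^sub>2 = f\<^sub>5 = 0\<close> and \<open>f\<^sub>1 = lam\<^sup>2\<close>, the second one, averaged over
  \<open>V\<close> and \<open>V'\<close>, forces \<open>f\<^sub>2 + 2 lam\<^sup>2 f\<^sub>5 - f\<^sub>1 = lam\<^sup>2\<close>. So \<open>lam = 0\<close>, a contradiction.

  All of this takes place in the module of global vector fields. What is used about its size is that
  there are \<open>DIM('e)\<close> vector fields with linearly independent values at a given point
  (\<open>vector_field_outside_span\<close>), for which bump functions are needed. The operators \<open>S\<close> and
  \<open>proj\<close> and the eigendistributions are accordingly treated as operators on, and submodules of, that module.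
\<close>

section \<open>Smooth functions on Euclidean spaces\<close>

lemma times_differentiable_on_cong:
  assumes "open S" "\<And>x. x \<in> S \<Longrightarrow> f x = g x"
  shows "times_differentiable_on k S f \<longleftrightarrow> times_differentiable_on k S g"
  using assms(2)
proof (induction k arbitrary: f g)
  case 0
  then show ?case by (simp cong: continuous_on_cong)
next
  case (Suc k)
  have *: "(f has_derivative D) (at x) \<longleftrightarrow> (g has_derivative D) (at x)" if "x \<in> S" for x D
    using that assms(1) Suc.prems
    by (metis has_derivative_transform_within_open)
  have "f differentiable (at x) \<longleftrightarrow> g differentiable (at x)" if "x \<in> S" for x
    using *[OF that] by (simp add: differentiable_def)
  moreover have "frechet_derivative f (at x) = frechet_derivative g (at x)" if "x \<in> S" for x
    using *[OF that] by (simp add: frechet_derivative_def)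
  moreover from this have "times_differentiable_on k S (\<lambda>x. frechet_derivative f (at x) v) \<longleftrightarrow>
      times_differentiable_on k S (\<lambda>x. frechet_derivative g (at x) v)" for v
    by (intro Suc.IH) simp
  ultimately show ?case
    by simp
qed

lemma times_differentiable_on_Un:
  assumes "open S" "open T" "times_differentiable_on k S f" "times_differentiable_on k T f"
  shows "times_differentiable_on k (S \<union> T) f"
  using assms(3,4)
  by (induction k arbitrary: f) (auto intro: continuous_on_open_Un assms(1,2))

lemma times_differentiable_on_subset:
  "times_differentiable_on k S f \<Longrightarrow> T \<subseteq> S \<Longrightarrow> times_differentiable_on k T f"
  by (induction k arbitrary: f) (auto intro: continuous_on_subset)

lemma times_differentiable_on_SucD:
  "times_differentiable_on (Suc k) S f \<Longrightarrow> times_differentiable_on k S f"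
proof (induction k arbitrary: f)
  case 0
  then show ?case
    by (simp add: differentiable_imp_continuous_on differentiable_at_imp_differentiable_on)
next
  case (Suc k)
  show ?case
    unfolding times_differentiable_on.simps(2)[of k]
  proof (intro conjI allI)
    show "\<forall>x\<in>S. f differentiable (at x)"
      using Suc.prems by simp
    show "times_differentiable_on k S (\<lambda>x. frechet_derivative f (at x) v)" for v
      using Suc.prems by (intro Suc.IH) auto
  qed
qed

lemma times_differentiable_on_SucI:
  assumes "open S" "\<And>x. x \<in> S \<Longrightarrow> (f has_derivative D x) (at x)"
    "\<And>v. times_differentiable_on k S (\<lambda>x. D x v)"
  shows "times_differentiable_on (Suc k) S f"
proof -
  have "frechet_derivative f (at x) = D x" if "x \<in> S" for x
    using assms(2)[OF that] by (metis frechet_derivative_at)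
  then have "times_differentiable_on k S (\<lambda>x. frechet_derivative f (at x) v) \<longleftrightarrow>
      times_differentiable_on k S (\<lambda>x. D x v)" for v
    by (intro times_differentiable_on_cong assms(1)) simp
  then show ?thesis
    using assms by (auto simp: differentiable_def)
qed

lemma times_differentiable_on_Suc_has_derivative:
  assumes "times_differentiable_on (Suc k) S f" "x \<in> S"
  shows "(f has_derivative frechet_derivative f (at x)) (at x)"
  using assms by (simp add: frechet_derivative_works)

lemma times_differentiable_on_const: "times_differentiable_on k S (\<lambda>x. c)"
  by (induction k arbitrary: c) (auto simp: frechet_derivative_const)

lemma times_differentiable_on_add:
  assumes "open S" "times_differentiable_on k S f" "times_differentiable_on k S g"
  shows "times_differentiable_on k S (\<lambda>x. f x + g x)"
  using assms(2,3)
proof (induction k arbitrary: f g)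
  case 0
  then show ?case by (auto intro: continuous_on_add)
next
  case (Suc k)
  show ?case
    by (rule times_differentiable_on_SucI[OF assms(1)
        has_derivative_add[OF times_differentiable_on_Suc_has_derivative[OF Suc.prems(1)]
          times_differentiable_on_Suc_has_derivative[OF Suc.prems(2)]]])
      (use Suc in auto)
qed

lemma times_differentiable_on_sum:
  assumes "open S" "\<And>i. i \<in> I \<Longrightarrow> times_differentiable_on k S (f i)"
  shows "times_differentiable_on k S (\<lambda>x. \<Sum>i\<in>I. f i x)"
  using assms(2)
  by (induction I rule: infinite_finite_induct)
    (auto intro: times_differentiable_on_const times_differentiable_on_add assms(1))

lemma times_differentiable_on_linear:
  assumes "open S" "bounded_linear L" "times_differentiable_on k S f"
  shows "times_differentiable_on k S (\<lambda>x. L (f x))"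
  using assms(3)
proof (induction k arbitrary: f)
  case 0
  then show ?case
    by (simp add: bounded_linear.continuous_on[OF assms(2)])
next
  case (Suc k)
  show ?case
    by (rule times_differentiable_on_SucI[OF assms(1)
        bounded_linear.has_derivative[OF assms(2)
          times_differentiable_on_Suc_has_derivative[OF Suc.prems]]])
      (use Suc in auto)
qed

lemma times_differentiable_on_ident:
  assumes "open S"
  shows "times_differentiable_on k S (\<lambda>x. x)"
proof (cases k)
  case (Suc l)
  show ?thesis
    unfolding Suc
    by (rule times_differentiable_on_SucI[OF assms has_derivative_ident])
      (rule times_differentiable_on_const)
qed simp

lemma times_differentiable_on_mult:
  fixes f g :: "'e::euclidean_space \<Rightarrow> real"
  assumes "open S" "times_differentiable_on k S f" "times_differentiable_on k S g"
  shows "times_differentiable_on k S (\<lambda>x. f x * g x)"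
  using assms(2,3)
proof (induction k arbitrary: f g)
  case 0
  then show ?case by (auto intro: continuous_on_mult)
next
  case (Suc k)
  show ?case
  proof (rule times_differentiable_on_SucI[OF assms(1)
        has_derivative_mult[OF times_differentiable_on_Suc_has_derivative[OF Suc.prems(1)]
          times_differentiable_on_Suc_has_derivative[OF Suc.prems(2)]]])
    fix v
    show "times_differentiable_on k S
        (\<lambda>x. f x * frechet_derivative g (at x) v + frechet_derivative f (at x) v * g x)"
      using Suc.prems(1,2)[THEN times_differentiable_on_SucD] Suc.prems
      by (intro times_differentiable_on_add Suc.IH assms(1)) auto
  qed
qed

text \<open>The induction needs a derivative that is again built from products and compositions, so the chain
  rule is expanded in the basis: \<open>D(g \<circ> f) v = (\<Sum>i. (Df v \<bullet> i) (\<partial>\<^sub>i g \<circ> f))\<close>.\<close>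

lemma times_differentiable_on_compose:
  fixes f :: "'e::euclidean_space \<Rightarrow> 'd::euclidean_space" and g :: "'d \<Rightarrow> real"
  assumes "open S" "f ` S \<subseteq> T" "times_differentiable_on k S f" "times_differentiable_on k T g"
  shows "times_differentiable_on k S (\<lambda>x. g (f x))"
  using assms(3,4)
proof (induction k arbitrary: g)
  case 0
  then show ?case
    using assms(2) by (auto intro: continuous_on_compose2)
next
  case (Suc k)
  define f' where "f' x = frechet_derivative f (at x)" for x
  define g' where "g' y = frechet_derivative g (at y)" for y
  have f': "(f has_derivative f' x) (at x)" if "x \<in> S" for x
    unfolding f'_def using times_differentiable_on_Suc_has_derivative[OF Suc.prems(1) that] .
  have g': "(g has_derivative g' (f x)) (at (f x))" if "x \<in> S" for x
    unfolding g'_def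
    using times_differentiable_on_Suc_has_derivative[OF Suc.prems(2)] assms(2) that by blast
  have expand: "g' (f x) (f' x v) = (\<Sum>i\<in>Basis. (f' x v \<bullet> i) * g' (f x) i)" if "x \<in> S" for x v
  proof -
    have lin: "linear (g' (f x))"
      using g'[OF that] by (rule has_derivative_linear)
    have "g' (f x) (f' x v) = g' (f x) (\<Sum>i\<in>Basis. (f' x v \<bullet> i) *\<^sub>R i)"
      by (simp add: euclidean_representation)
    then show ?thesis
      by (simp add: linear_sum[OF lin] linear_cmul[OF lin])
  qed
  show ?case
  proof (rule times_differentiable_on_SucI[OF assms(1)])
    show "((\<lambda>x. g (f x)) has_derivative (\<lambda>v. \<Sum>i\<in>Basis. (f' x v \<bullet> i) * g' (f x) i)) (at x)"
      if "x \<in> S" for x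
      using has_derivative_compose[OF f'[OF that] g'[OF that]] expand[OF that] by simp
    show "times_differentiable_on k S (\<lambda>x. \<Sum>i\<in>Basis. (f' x v \<bullet> i) * g' (f x) i)" for v
    proof (intro times_differentiable_on_sum times_differentiable_on_mult assms(1))
      show "times_differentiable_on k S (\<lambda>x. f' x v \<bullet> i)" for i
        using Suc.prems(1)
        by (intro times_differentiable_on_linear[OF assms(1) bounded_linear_inner_left])
          (simp add: f'_def)
      show "times_differentiable_on k S (\<lambda>x. g' (f x) i)" for i
        using Suc.prems(2) times_differentiable_on_SucD[OF Suc.prems(1)]
        by (intro Suc.IH[of "\<lambda>y. g' y i"]) (simp_all add: g'_def)
    qed
  qed
qed

lemma times_differentiable_on_powr:
  "times_differentiable_on k {0<..} (\<lambda>x::real. x powr a)"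
proof (induction k arbitrary: a)
  case 0
  have "continuous_on {0<..} (\<lambda>x::real. x powr a)"
    by (rule continuous_on_powr[OF continuous_on_id continuous_on_const]) simp
  then show ?case by simp
next
  case (Suc k)
  show ?case
  proof (rule times_differentiable_on_SucI)
    show "((\<lambda>x. x powr a) has_derivative (\<lambda>v. v * (a * x powr (a - 1)))) (at x)"
      if "x \<in> {0<..}" for x :: real
      using has_real_derivative_powr[of x a] that
      by (simp add: has_field_derivative_def mult_commute_abs)
    show "times_differentiable_on k {0<..} (\<lambda>x. v * (a * x powr (a - 1)))" for v
      by (rule times_differentiable_on_mult[OF _ times_differentiable_on_const
            times_differentiable_on_mult[OF _ times_differentiable_on_const Suc]]) auto
  qed simp
qed

text \<open>Differentiating \<open>exp (- 1 / t)\<close> produces inverse powers of \<open>t\<close>. With the factor \<open>t\<^sup>-\<^sup>m\<close> included, the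
  derivative of a member of the family is a linear combination of members, so that one induction treats
  the derivatives of all orders.\<close>

definition flat_exp :: "nat \<Rightarrow> real \<Rightarrow> real" where
  "flat_exp m t = (if t \<le> 0 then 0 else exp (- inverse t) * inverse t ^ m)"

lemma flat_exp_tendsto_0: "(flat_exp m \<longlongrightarrow> 0) (at 0)"
proof -
  have "((\<lambda>t::real. inverse t ^ m / exp (inverse t)) \<longlongrightarrow> 0) (at_right 0)"
    using filterlim_compose[OF tendsto_power_div_exp_0 filterlim_inverse_at_top_right] .
  then have "(flat_exp m \<longlongrightarrow> 0) (at_right 0)"
  proof (rule Lim_transform_eventually)
    show "\<forall>\<^sub>F t in at_right 0. inverse t ^ m / exp (inverse t) = flat_exp m t"
      using eventually_at_right_less[of "0::real"]
      by eventually_elim (simp add: flat_exp_def exp_minus field_simps)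
  qed
  moreover have "(flat_exp m \<longlongrightarrow> 0) (at_left 0)"
  proof (rule Lim_transform_eventually[OF tendsto_const])
    show "\<forall>\<^sub>F t in at_left 0. 0 = flat_exp m t"
      using eventually_at_leftI[of "-1" 0 "\<lambda>t. 0 = flat_exp m t"] by (simp add: flat_exp_def)
  qed
  ultimately show ?thesis
    using filterlim_split_at_real by blast
qed

lemma flat_exp_has_real_derivative:
  "(flat_exp m has_real_derivative flat_exp (m + 2) t - m * flat_exp (m + 1) t) (at t)"
proof -
  consider "t < 0" | "t = 0" | "t > 0" by linarith
  then show ?thesis
  proof cases
    case 1
    have "((\<lambda>_. 0) has_real_derivative 0) (at t)" by simp
    then have "(flat_exp m has_real_derivative 0) (at t)"
      by (rule has_field_derivative_transform_within_open[where S = "{..<0}"])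
        (use 1 in \<open>auto simp: flat_exp_def\<close>)
    with 1 show ?thesis by (simp add: flat_exp_def)
  next
    case 2
    have "((\<lambda>t. (flat_exp m t - flat_exp m 0) / (t - 0)) \<longlongrightarrow> 0) (at 0)"
    proof (rule Lim_transform_eventually[OF flat_exp_tendsto_0[of "m + 1"]])
      show "\<forall>\<^sub>F t in at 0. flat_exp (m + 1) t = (flat_exp m t - flat_exp m 0) / (t - 0)"
        by (auto simp: flat_exp_def field_simps eventually_at_filter)
    qed
    then show ?thesis
      using 2 by (simp add: has_field_derivative_iff flat_exp_def)
  next
    case 3
    have inv: "(inverse has_real_derivative - ((inverse t)\<^sup>2)) (at t)"
      using DERIV_inverse[of t UNIV] 3 by (simp add: power2_eq_square)
    have "((\<lambda>t. exp (- inverse t)) has_real_derivative exp (- inverse t) * (inverse t)\<^sup>2) (at t)"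
      using DERIV_fun_exp[OF DERIV_minus[OF inv]] by simp
    from DERIV_mult[OF this DERIV_power[OF inv, of m]]
    have "((\<lambda>t. exp (- inverse t) * inverse t ^ m) has_real_derivative
        exp (- inverse t) * (inverse t)\<^sup>2 * inverse t ^ m
          + real m * (- ((inverse t)\<^sup>2) * inverse t ^ (m - Suc 0)) * exp (- inverse t)) (at t)"
      by simp
    also have "exp (- inverse t) * (inverse t)\<^sup>2 * inverse t ^ m
          + real m * (- ((inverse t)\<^sup>2) * inverse t ^ (m - Suc 0)) * exp (- inverse t)
        = flat_exp (m + 2) t - m * flat_exp (m + 1) t"
      using 3 by (cases m) (simp_all add: flat_exp_def power2_eq_square mult_ac del: power_inverse inverse_mult_distrib)
    finally show ?thesis
      by (rule has_field_derivative_transform_within_open[where S = "{0<..}"])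
        (use 3 in \<open>auto simp: flat_exp_def\<close>)
  qed
qed

lemma times_differentiable_on_flat_exp: "times_differentiable_on k UNIV (flat_exp m)"
proof (induction k arbitrary: m)
  case 0
  show ?case
    using flat_exp_has_real_derivative
    by (auto intro!: DERIV_continuous_on)
next
  case (Suc k)
  have deriv: "(flat_exp m has_derivative
      (\<lambda>v. v * (flat_exp (m + 2) t + (- real m) * flat_exp (m + 1) t))) (at t)" for t
    using flat_exp_has_real_derivative[of m t]
    by (simp add: has_field_derivative_def mult_commute_abs)
  show ?case
    by (rule times_differentiable_on_SucI[OF _ deriv])
      (intro open_UNIV times_differentiable_on_mult times_differentiable_on_add
        times_differentiable_on_const Suc)+
qed

lemma flat_exp_0_pos_iff: "0 < flat_exp 0 t \<longleftrightarrow> 0 < t"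
  by (simp add: flat_exp_def)

lemma flat_exp_0_nonpos: "t \<le> 0 \<Longrightarrow> flat_exp m t = 0"
  by (simp add: flat_exp_def)

text \<open>The function \<open>exp (- 1 / t)\<close>, extended by 0, composed with \<open>r\<^sup>2 - |x - x0|\<^sup>2\<close>.\<close>

lemma smooth_bump_function:
  fixes x0 :: "'e::euclidean_space"
  assumes "0 < r"
  obtains \<beta> :: "'e \<Rightarrow> real"
  where "smooth_on UNIV \<beta>" "0 < \<beta> x0" "\<And>x. x \<notin> cball x0 r \<Longrightarrow> \<beta> x = 0"
proof
  let ?q = "\<lambda>x::'e. r\<^sup>2 + (- 1) * (\<Sum>i\<in>Basis. ((x \<bullet> i) + (- (x0 \<bullet> i))) * ((x \<bullet> i) + (- (x0 \<bullet> i))))"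
  have "(\<Sum>i\<in>Basis. ((x \<bullet> i) + (- (x0 \<bullet> i))) * ((x \<bullet> i) + (- (x0 \<bullet> i)))) = (dist x0 x)\<^sup>2" for x
    unfolding dist_norm power2_norm_eq_inner euclidean_inner[of "x0 - x" "x0 - x"]
    by (intro sum.cong refl) (simp add: inner_diff_left algebra_simps)
  then have q: "?q x = r\<^sup>2 - (dist x0 x)\<^sup>2" for x
    by simp
  have "times_differentiable_on k UNIV ?q" for k
    by (intro open_UNIV times_differentiable_on_add times_differentiable_on_const
        times_differentiable_on_mult times_differentiable_on_sum
        times_differentiable_on_linear[OF _ bounded_linear_inner_left] times_differentiable_on_ident)
  then show "smooth_on UNIV (\<lambda>x. flat_exp 0 (?q x))"
    unfolding smooth_on_def
    by (intro allI times_differentiable_on_compose[OF open_UNIV _ _ times_differentiable_on_flat_exp])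
       auto
  show "0 < flat_exp 0 (?q x0)"
    unfolding q flat_exp_0_pos_iff using assms by simp
  show "flat_exp 0 (?q x) = 0" if "x \<notin> cball x0 r" for x
    unfolding q using that assms
    by (intro flat_exp_0_nonpos) (auto intro!: power_mono)
qed

section \<open>Smooth functions and vector fields on manifolds\<close>

context smooth_manifold
begin

lemma chart_subset: "(U, c) \<in> A \<Longrightarrow> U \<subseteq> M"
  using chart_domain_open openin_subset by blast

lemma chart_inj: "(U, c) \<in> A \<Longrightarrow> inj_on c U"
  using chart_homeomorphic[of U c] chart_subset[of U c]
  by (simp add: homeomorphic_map_def Int_absorb1)

lemma chart_inverse: "(U, c) \<in> A \<Longrightarrow> q \<in> U \<Longrightarrow> inv_into U c (c q) = q"
  using chart_inj by (simp add: inv_into_f_f)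

lemma chart_around:
  assumes "p \<in> M"
  obtains U c where "(U, c) \<in> A" "p \<in> U"
proof -
  from assms have "p \<in> \<Union> (fst ` A)"
    using charts_cover by simp
  then obtain V where "V \<in> A" "p \<in> fst V"
    by blast
  then show thesis
    using that by (metis prod.collapse)
qed

lemma open_chart_image:
  assumes "(U, c) \<in> A" "openin T W"
  shows "open (c ` (U \<inter> W))"
proof -
  have "openin (subtopology T U) (U \<inter> W)"
    using assms(2) by (simp add: openin_subtopology_Int2)
  then have "openin (top_of_set (c ` U)) (c ` (U \<inter> W))"
    using homeomorphic_imp_open_map[OF chart_homeomorphic[OF assms(1)]]
    by (simp add: open_map_def)
  then show ?thesis
    using chart_image_open[OF assms(1)] openin_open_trans by blast
qed

lemma continuous_chart_inverse:
  assumes "(U, c) \<in> A"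
  shows "continuous_map (top_of_set (c ` U)) T (inv_into U c)"
proof -
  obtain k where k: "homeomorphic_maps (subtopology T U) (top_of_set (c ` U)) c k"
    using chart_homeomorphic[OF assms] homeomorphic_map_maps by blast
  then have "continuous_map (top_of_set (c ` U)) T k"
    by (auto simp: homeomorphic_maps_def continuous_map_in_subtopology)
  moreover have "k x = inv_into U c x" if "x \<in> c ` U" for x
    using k that chart_subset[OF assms] chart_inverse[OF assms]
    by (force simp: homeomorphic_maps_def)
  ultimately show ?thesis
    by (rule continuous_map_eq) simp
qed

lemma smooth_fun_iff:
  "smooth_fun f \<longleftrightarrow>
     (\<forall>U c k. (U, c) \<in> A \<longrightarrow> times_differentiable_on k (c ` U) (\<lambda>x. f (inv_into U c x)))"
  by (auto simp: smooth_fun_def smooth_on_def comp_def)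

lemma smooth_fun_in_chart:
  "smooth_fun f \<Longrightarrow> (U, c) \<in> A \<Longrightarrow> times_differentiable_on k (c ` U) (\<lambda>x. f (inv_into U c x))"
  by (simp add: smooth_fun_iff)

lemma smooth_fun_cong:
  assumes "\<And>q. q \<in> M \<Longrightarrow> f q = k q"
  shows "smooth_fun f \<longleftrightarrow> smooth_fun k"
proof -
  have "f (inv_into U c x) = k (inv_into U c x)" if "(U, c) \<in> A" "x \<in> c ` U" for U c x
    using assms that chart_subset inv_into_into by (metis subsetD)
  then have "times_differentiable_on n (c ` U) (\<lambda>x. f (inv_into U c x)) \<longleftrightarrow>
      times_differentiable_on n (c ` U) (\<lambda>x. k (inv_into U c x))" if "(U, c) \<in> A" for U c n
    using that by (intro times_differentiable_on_cong[OF chart_image_open]) auto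
  then show ?thesis
    unfolding smooth_fun_iff by blast
qed

lemma smooth_fun_const: "smooth_fun (\<lambda>q. r)"
  by (simp add: smooth_fun_iff times_differentiable_on_const)

lemma smooth_fun_add: "smooth_fun f \<Longrightarrow> smooth_fun k \<Longrightarrow> smooth_fun (\<lambda>q. f q + k q)"
  by (simp add: smooth_fun_iff times_differentiable_on_add chart_image_open)

lemma smooth_fun_mult: "smooth_fun f \<Longrightarrow> smooth_fun k \<Longrightarrow> smooth_fun (\<lambda>q. f q * k q)"
  by (simp add: smooth_fun_iff times_differentiable_on_mult chart_image_open)

lemma smooth_fun_scale: "smooth_fun f \<Longrightarrow> smooth_fun (\<lambda>q. r * f q)"
  by (intro smooth_fun_mult smooth_fun_const)

lemma smooth_fun_diff: "smooth_fun f \<Longrightarrow> smooth_fun k \<Longrightarrow> smooth_fun (\<lambda>q. f q - k q)"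
  using smooth_fun_add[of f "\<lambda>q. (- 1) * k q"] smooth_fun_scale[of k "- 1"] by simp

lemma smooth_fun_sqrt:
  assumes "smooth_fun f" "\<And>q. q \<in> M \<Longrightarrow> 0 < f q"
  shows "smooth_fun (\<lambda>q. sqrt (f q))"
proof -
  have "times_differentiable_on k (c ` U) (\<lambda>x. f (inv_into U c x) powr (1 / 2))"
    if "(U, c) \<in> A" for U c k
  proof (rule times_differentiable_on_compose[where T = "{0<..}" and g = "\<lambda>t. t powr (1 / 2)"])
    have "inv_into U c x \<in> M" if "x \<in> c ` U" for x
      using chart_subset[OF \<open>(U, c) \<in> A\<close>] inv_into_into[OF that] by blast
    then show "(\<lambda>x. f (inv_into U c x)) ` c ` U \<subseteq> {0<..}"
      using assms(2) by auto
  qed (rule chart_image_open smooth_fun_in_chart assms that times_differentiable_on_powr)+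
  then have "smooth_fun (\<lambda>q. f q powr (1 / 2))"
    by (simp add: smooth_fun_iff)
  moreover have "f q powr (1 / 2) = sqrt (f q)" if "q \<in> M" for q
    using assms(2)[OF that] by (simp add: powr_half_sqrt)
  ultimately show ?thesis
    by (subst (asm) smooth_fun_cong)
qed

text \<open>Extension by zero: a chart that does not meet \<open>K\<close> sees the zero function, and where another
  chart meets \<open>U\<close> the transition map carries the smoothness over.\<close>

lemma smooth_fun_extend_by_zero:
  assumes "(U, c) \<in> A" "closedin T K" "K \<subseteq> U"
    and smooth: "\<And>k. times_differentiable_on k (c ` U) (\<lambda>x. F (inv_into U c x))"
    and zero: "\<And>q. q \<in> M - K \<Longrightarrow> F q = 0"
  shows "smooth_fun F"
  unfolding smooth_fun_iff
proof (intro allI impI)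
  fix V d k
  assume V: "(V, d) \<in> A"
  have openU: "open (d ` (V \<inter> U))"
    by (intro open_chart_image V chart_domain_open[OF assms(1)])
  have openK: "open (d ` (V \<inter> (M - K)))"
    by (intro open_chart_image V openin_diff openin_topspace assms(2))
  have "times_differentiable_on k (d ` (V \<inter> U)) (\<lambda>x. F (inv_into U c (c (inv_into V d x))))"
  proof (rule times_differentiable_on_compose[OF openU, where T = "c ` U" and g = "\<lambda>x. F (inv_into U c x)"])
    show "times_differentiable_on k (d ` (V \<inter> U)) (\<lambda>x. c (inv_into V d x))"
      using charts_compatible[OF V assms(1)] by (simp add: smooth_on_def comp_def)
    show "times_differentiable_on k (c ` U) (\<lambda>x. F (inv_into U c x))"
      by (rule smooth)
    show "(\<lambda>x. c (inv_into V d x)) ` d ` (V \<inter> U) \<subseteq> c ` U"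
      using chart_inverse[OF V] by auto
  qed
  moreover have "F (inv_into U c (c (inv_into V d x))) = F (inv_into V d x)" if "x \<in> d ` (V \<inter> U)" for x
    using that chart_inverse[OF V] chart_inverse[OF assms(1)] by auto
  ultimately have "times_differentiable_on k (d ` (V \<inter> U)) (\<lambda>x. F (inv_into V d x))"
    by (subst (asm) times_differentiable_on_cong[OF openU])
  moreover have "times_differentiable_on k (d ` (V \<inter> (M - K))) (\<lambda>x. F (inv_into V d x)) \<longleftrightarrow>
      times_differentiable_on k (d ` (V \<inter> (M - K))) (\<lambda>x. 0 :: real)"
    using chart_inverse[OF V] zero by (intro times_differentiable_on_cong openK) auto
  then have "times_differentiable_on k (d ` (V \<inter> (M - K))) (\<lambda>x. F (inv_into V d x))"
    by (simp only: times_differentiable_on_const)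
  ultimately have "times_differentiable_on k (d ` (V \<inter> U) \<union> d ` (V \<inter> (M - K))) (\<lambda>x. F (inv_into V d x))"
    by (intro times_differentiable_on_Un openU openK)
  moreover have "d ` (V \<inter> U) \<union> d ` (V \<inter> (M - K)) = d ` V"
    using chart_subset[OF V] assms(3) by blast
  ultimately show "times_differentiable_on k (d ` V) (\<lambda>x. F (inv_into V d x))"
    by simp
qed

lemma chart_bump_function:
  assumes "(U, c) \<in> A" "p \<in> U"
  obtains K \<beta> where "closedin T K" "K \<subseteq> U" "smooth_on UNIV \<beta>"
    "0 < (\<beta> (c p) :: real)" "\<forall>q \<in> U - K. \<beta> (c q) = 0"
proof -
  obtain r where r: "0 < r" "cball (c p) r \<subseteq> c ` U"
    using chart_image_open[OF assms(1)] assms(2) open_contains_cball by blast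
  obtain \<beta> :: "'e \<Rightarrow> real" where \<beta>: "smooth_on UNIV \<beta>" "0 < \<beta> (c p)"
      "\<And>x. x \<notin> cball (c p) r \<Longrightarrow> \<beta> x = 0"
    using smooth_bump_function[OF r(1)] by blast
  let ?K = "inv_into U c ` cball (c p) r"
  show thesis
  proof
    have "compactin (top_of_set (c ` U)) (cball (c p) r)"
      using r(2) by (simp add: compactin_subtopology)
    then have "compactin T ?K"
      using image_compactin continuous_chart_inverse[OF assms(1)] by blast
    then show "closedin T ?K"
      using compactin_imp_closedin Hausdorff by blast
    show "?K \<subseteq> U"
      using r(2) by (blast intro: inv_into_into)
    show "\<forall>q \<in> U - ?K. \<beta> (c q) = 0"
    proof (intro ballI \<beta>(3))
      show "c q \<notin> cball (c p) r" if "q \<in> U - ?K" for q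
        using that imageI[of "c q" "cball (c p) r" "inv_into U c"] chart_inverse[OF assms(1), of q]
        by auto
    qed
  qed (rule \<beta>(1,2))+
qed

text \<open>The coordinate vector field in direction \<open>v\<close>, multiplied by a cut-off function \<open>\<beta>\<close> with support in
  the chart; the extension by zero is what makes it a global vector field.\<close>

definition coordinate_field :: "'a set \<Rightarrow> ('a \<Rightarrow> 'e) \<Rightarrow> ('e \<Rightarrow> real) \<Rightarrow> 'e \<Rightarrow> 'a field" where
  "coordinate_field U c \<beta> v = (\<lambda>q f. if q \<in> U \<and> smooth_fun f
     then \<beta> (c q) * frechet_derivative (\<lambda>x. f (inv_into U c x)) (at (c q)) v else 0)"

lemma coordinate_field_in_tangent_space:
  assumes "(U, c) \<in> A"
  shows "coordinate_field U c \<beta> v q \<in> tangent_space q"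
proof (cases "q \<in> U")
  case True
  have deriv: "((\<lambda>x. f (inv_into U c x)) has_derivative
      frechet_derivative (\<lambda>x. f (inv_into U c x)) (at (c q))) (at (c q))" if "smooth_fun f" for f
    using times_differentiable_on_Suc_has_derivative[OF smooth_fun_in_chart[OF that assms]] True
    by blast
  have eq: "frechet_derivative F (at x) = D" if "(F has_derivative D) (at x)" for F :: "'e \<Rightarrow> real" and D x
    using frechet_derivative_at[OF that] by simp
  have scale: "((\<lambda>x. a * f (inv_into U c x)) has_derivative
      (\<lambda>v. a * frechet_derivative (\<lambda>x. f (inv_into U c x)) (at (c q)) v)) (at (c q))"
    if "smooth_fun f" for f a
    by (rule has_derivative_mult_right[OF deriv[OF that]])
  have add: "frechet_derivative (\<lambda>x. a * f (inv_into U c x) + b * k (inv_into U c x)) (at (c q)) v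
      = a * frechet_derivative (\<lambda>x. f (inv_into U c x)) (at (c q)) v
        + b * frechet_derivative (\<lambda>x. k (inv_into U c x)) (at (c q)) v"
    if "smooth_fun f" "smooth_fun k" for f k a b
    by (rule eq[OF has_derivative_add[OF scale scale], THEN fun_cong]) fact+
  have mult: "frechet_derivative (\<lambda>x. f (inv_into U c x) * k (inv_into U c x)) (at (c q)) v
      = f q * frechet_derivative (\<lambda>x. k (inv_into U c x)) (at (c q)) v
        + frechet_derivative (\<lambda>x. f (inv_into U c x)) (at (c q)) v * k q"
    if "smooth_fun f" "smooth_fun k" for f k
    using eq[OF has_derivative_mult[OF deriv deriv], THEN fun_cong, OF that]
    by (simp add: chart_inverse[OF assms True])
  show ?thesis
    by (auto simp: coordinate_field_def tangent_space_def True add mult smooth_fun_add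
        smooth_fun_mult smooth_fun_scale algebra_simps)
next
  case False
  then show ?thesis
    by (simp add: coordinate_field_def tangent_space_def)
qed

lemma vector_field_coordinate_field:
  assumes "(U, c) \<in> A" "closedin T K" "K \<subseteq> U" "smooth_on UNIV \<beta>" "\<forall>q \<in> U - K. \<beta> (c q) = 0"
  shows "vector_field (coordinate_field U c \<beta> v)"
  unfolding vector_field_def
proof (intro conjI ballI allI impI)
  fix f assume f: "smooth_fun f"
  show "smooth_fun (act (coordinate_field U c \<beta> v) f)"
  proof (rule smooth_fun_extend_by_zero[OF assms(1-3)])
    fix k
    let ?D = "\<lambda>x. \<beta> x * frechet_derivative (\<lambda>x. f (inv_into U c x)) (at x) v"
    have "times_differentiable_on k (c ` U) ?D"
    proof (rule times_differentiable_on_mult)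
      show "times_differentiable_on k (c ` U) \<beta>"
        using assms(4) by (auto simp: smooth_on_def intro: times_differentiable_on_subset)
      show "times_differentiable_on k (c ` U) (\<lambda>x. frechet_derivative (\<lambda>x. f (inv_into U c x)) (at x) v)"
        using smooth_fun_in_chart[OF f assms(1), of "Suc k"] by simp
    qed (rule chart_image_open[OF assms(1)])
    moreover have "act (coordinate_field U c \<beta> v) f (inv_into U c x) = ?D x" if "x \<in> c ` U" for x
      using that f by (simp add: act_def coordinate_field_def inv_into_into f_inv_into_f)
    ultimately show "times_differentiable_on k (c ` U)
        (\<lambda>x. act (coordinate_field U c \<beta> v) f (inv_into U c x))"
      by (subst times_differentiable_on_cong[OF chart_image_open[OF assms(1)]])
  next
    fix q assume "q \<in> M - K"
    then show "act (coordinate_field U c \<beta> v) f q = 0"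
      using assms(5) by (simp add: act_def coordinate_field_def)
  qed
qed (rule coordinate_field_in_tangent_space[OF assms(1)])

text \<open>The cut-off coordinate fields at \<open>p\<close> are dual, up to a positive factor, to the cut-off centred
  coordinate functions. Centring makes the derivative of the cut-off factor drop out at \<open>p\<close>.\<close>

lemma dual_fields_and_functions:
  assumes "p \<in> M"
  obtains E F and a :: real where "\<forall>i::'e. vector_field (E i)" "0 < a"
    "\<forall>i\<in>Basis. \<forall>j\<in>Basis. E i p (F j) = (if i = j then a else 0)"
proof -
  obtain U c where U: "(U, c) \<in> A" "p \<in> U"
    using chart_around assms by blast
  obtain K and \<beta> :: "'e \<Rightarrow> real" where K: "closedin T K" "K \<subseteq> U" and smooth: "smooth_on UNIV \<beta>"
    and pos: "0 < \<beta> (c p)" and zero: "\<forall>q \<in> U - K. \<beta> (c q) = 0"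
    using chart_bump_function[OF U] by blast
  have \<beta>: "times_differentiable_on k UNIV \<beta>" for k
    using smooth by (simp add: smooth_on_def)
  define F where "F j q = (if q \<in> U then \<beta> (c q) * (c q \<bullet> j + - (c p \<bullet> j)) else 0)" for j q
  have inU: "F j (inv_into U c x) = \<beta> x * (x \<bullet> j + - (c p \<bullet> j))" if "x \<in> c ` U" for x j
    using that by (simp add: F_def inv_into_into f_inv_into_f)
  have F: "smooth_fun (F j)" for j
  proof (rule smooth_fun_extend_by_zero[OF U(1) K])
    fix k
    note openU = chart_image_open[OF U(1)]
    have "times_differentiable_on k (c ` U) (\<lambda>x. x \<bullet> j + - (c p \<bullet> j))"
      by (rule times_differentiable_on_add[OF openU
            times_differentiable_on_linear[OF openU bounded_linear_inner_left
              times_differentiable_on_ident[OF openU]] times_differentiable_on_const])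
    then have "times_differentiable_on k (c ` U) (\<lambda>x. \<beta> x * (x \<bullet> j + - (c p \<bullet> j)))"
      by (rule times_differentiable_on_mult[OF openU times_differentiable_on_subset[OF \<beta> subset_UNIV]])
    then show "times_differentiable_on k (c ` U) (\<lambda>x. F j (inv_into U c x))"
      by (subst times_differentiable_on_cong[OF chart_image_open[OF U(1)]]) (simp_all add: inU)
  qed (use zero in \<open>auto simp: F_def\<close>)
  have "coordinate_field U c \<beta> i p (F j) = (if i = j then (\<beta> (c p))\<^sup>2 else 0)"
    if "i \<in> Basis" "j \<in> Basis" for i j
  proof -
    have "(\<beta> has_derivative frechet_derivative \<beta> (at (c p))) (at (c p))"
      using times_differentiable_on_Suc_has_derivative[OF \<beta>] by simp
    moreover have "((\<lambda>x. x \<bullet> j + - (c p \<bullet> j)) has_derivative (\<lambda>v. v \<bullet> j)) (at (c p))"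
      by (auto intro!: derivative_eq_intros)
    ultimately have "((\<lambda>x. \<beta> x * (x \<bullet> j + - (c p \<bullet> j))) has_derivative
        (\<lambda>v. \<beta> (c p) * (v \<bullet> j) + frechet_derivative \<beta> (at (c p)) v * (c p \<bullet> j + - (c p \<bullet> j)))) (at (c p))"
      by (rule has_derivative_mult)
    then have "((\<lambda>x. \<beta> x * (x \<bullet> j + - (c p \<bullet> j))) has_derivative (\<lambda>v. \<beta> (c p) * (v \<bullet> j))) (at (c p))"
      by simp
    then have "((\<lambda>x. F j (inv_into U c x)) has_derivative (\<lambda>v. \<beta> (c p) * (v \<bullet> j))) (at (c p))"
      by (rule has_derivative_transform_within_open[OF _ chart_image_open[OF U(1)]])
        (use U(2) inU in auto)
    then have "frechet_derivative (\<lambda>x. F j (inv_into U c x)) (at (c p)) i = \<beta> (c p) * (i \<bullet> j)"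
      by (simp add: frechet_derivative_at[symmetric])
    then show ?thesis
      using that U(2) F by (simp add: coordinate_field_def inner_Basis power2_eq_square)
  qed
  moreover have "vector_field (coordinate_field U c \<beta> i)" for i
    by (rule vector_field_coordinate_field[OF U(1) K smooth zero])
  ultimately show thesis
    using that[of "coordinate_field U c \<beta>" "(\<beta> (c p))\<^sup>2" F] pos by simp
qed

text \<open>The dual functions witness the linear independence of \<open>DIM('e)\<close> values. This lemma is the only
  source of information about the dimension in what follows.\<close>

lemma vector_field_outside_span:
  assumes "p \<in> M" "finite S" "card S < DIM('e)"
  obtains X where "vector_field X" "X p \<notin> span S"
proof (rule ccontr)
  assume "\<not> thesis"
  then have spanned: "vector_field X \<Longrightarrow> X p \<in> span S" for X
    using that[of X] by satx
  obtain E F and a :: real where E: "\<forall>i::'e. vector_field (E i)" and a: "0 < a"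
    and EF: "\<forall>i\<in>Basis. \<forall>j\<in>Basis. E i p (F j) = (if i = j then a else 0)"
    by (rule dual_fields_and_functions[OF assms(1)], rule that)
  let ?B = "(\<lambda>i. E i p) ` Basis"
  have inj: "inj_on (\<lambda>i. E i p) Basis"
    using EF a by (intro inj_onI) (metis less_irrefl)
  have "independent ?B"
    unfolding dependent_def
  proof safe
    fix i :: 'e assume i: "i \<in> Basis" and dep: "E i p \<in> span (?B - {E i p})"
    have lin: "linear (\<lambda>v::'a tangent. v (F i))"
      by (auto intro!: linearI simp: scaleR_fun_def)
    have "x (F i) = 0" if "x \<in> ?B - {E i p}" for x
      using that EF i by auto
    then have "E i p (F i) = 0"
      using linear_eq_0_on_span[OF lin _ dep] by simp
    then show False
      using EF i a by simp
  qed
  moreover have "?B \<subseteq> span S"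
    using spanned E by blast
  ultimately have "card ?B \<le> card S"
    using independent_span_bound assms(2) by blast
  then show False
    using assms(3) by (simp add: card_image[OF inj])
qed

end

lemma field_scaleR_apply: "(r *\<^sub>R X) p = r *\<^sub>R X p"
  by (simp add: scaleR_fun_def)

context smooth_manifold
begin

lemma subspace_tangent_space: "subspace (tangent_space p)"
  by (auto simp: subspace_def tangent_space_def scaleR_fun_def algebra_simps)

lemmas tangent_intros =
  subspace_0[OF subspace_tangent_space] subspace_add[OF subspace_tangent_space]
  subspace_diff[OF subspace_tangent_space] subspace_neg[OF subspace_tangent_space]
  subspace_scale[OF subspace_tangent_space]

lemma vector_field_at: "vector_field X \<Longrightarrow> p \<in> M \<Longrightarrow> X p \<in> tangent_space p"
  by (simp add: vector_field_def)

lemma smooth_act: "vector_field X \<Longrightarrow> smooth_fun f \<Longrightarrow> smooth_fun (act X f)"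
  by (simp add: vector_field_def)

lemma act_linear:
  "vector_field X \<Longrightarrow> p \<in> M \<Longrightarrow> smooth_fun f \<Longrightarrow> smooth_fun k \<Longrightarrow>
    act X (\<lambda>q. a * f q + b * k q) p = a * act X f p + b * act X k p"
  by (auto simp: vector_field_def tangent_space_def act_def)

lemma act_mult:
  "vector_field X \<Longrightarrow> p \<in> M \<Longrightarrow> smooth_fun f \<Longrightarrow> smooth_fun k \<Longrightarrow>
    act X (\<lambda>q. f q * k q) p = f p * act X k p + k p * act X f p"
  by (auto simp: vector_field_def tangent_space_def act_def)

lemma act_const: 
  assumes "vector_field X" "p \<in> M"
  shows "act X (\<lambda>q. r) p = 0"
  using act_mult[OF assms smooth_fun_const[of 1] smooth_fun_const[of 1]]
    act_linear[OF assms smooth_fun_const[of 1] smooth_fun_const[of 1], of r 0]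
  by simp

lemma smooth_indicator_outside: "smooth_fun (\<lambda>q. if q \<in> M then 0 else 1)"
  by (subst smooth_fun_cong[of _ "\<lambda>q. 0"]) (auto intro: smooth_fun_const)

text \<open>The difference of the two functions equals its product with the function that is 0 on \<open>M\<close> and 1
  elsewhere, and the Leibniz rule annihilates such a product on \<open>M\<close>.\<close>

lemma act_cong:
  assumes "vector_field X" "p \<in> M" "smooth_fun f" "\<And>q. q \<in> M \<Longrightarrow> f q = k q"
  shows "act X f p = act X k p"
proof -
  let ?d = "\<lambda>q. k q - f q" and ?out = "\<lambda>q. if q \<in> M then 0 else 1 :: real"
  have k: "smooth_fun k"
    using assms(3,4) smooth_fun_cong by blast
  have d: "smooth_fun ?d"
    using k assms(3) by (rule smooth_fun_diff)
  have "?d = (\<lambda>q. ?d q * ?out q)"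
    using assms(4) by auto
  then have "act X ?d p = 0"
    using act_mult[OF assms(1,2) d smooth_indicator_outside] assms(2,4) by simp
  then show ?thesis
    using act_linear[OF assms(1,2) d assms(3), of 1 1] by simp
qed

lemma vector_field_cong:
  assumes "\<And>q. q \<in> M \<Longrightarrow> X q = Y q"
  shows "vector_field X \<longleftrightarrow> vector_field Y"
proof -
  have "smooth_fun (act X f) \<longleftrightarrow> smooth_fun (act Y f)" for f
    by (rule smooth_fun_cong) (simp add: act_def assms)
  then show ?thesis
    using assms by (auto simp: vector_field_def)
qed

lemma vector_field_linear_combination:
  assumes "vector_field X" "vector_field Y" "smooth_fun a" "smooth_fun b"
  shows "vector_field (\<lambda>q. a q *\<^sub>R X q + b q *\<^sub>R Y q)"
  unfolding vector_field_def
proof (intro conjI ballI allI impI)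
  show "a q *\<^sub>R X q + b q *\<^sub>R Y q \<in> tangent_space q" if "q \<in> M" for q
    by (intro tangent_intros vector_field_at assms that)
  fix f assume "smooth_fun f"
  then have "smooth_fun (\<lambda>q. a q * act X f q + b q * act Y f q)"
    by (intro smooth_fun_add smooth_fun_mult smooth_act assms)
  then show "smooth_fun (act (\<lambda>q. a q *\<^sub>R X q + b q *\<^sub>R Y q) f)"
    by (simp add: act_def scaleR_fun_def)
qed

lemma vector_field_add: "vector_field X \<Longrightarrow> vector_field Y \<Longrightarrow> vector_field (\<lambda>q. X q + Y q)"
  using vector_field_linear_combination[OF _ _ smooth_fun_const[of 1] smooth_fun_const[of 1]] by simp

lemma vector_field_diff: "vector_field X \<Longrightarrow> vector_field Y \<Longrightarrow> vector_field (\<lambda>q. X q - Y q)"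
  using vector_field_linear_combination[OF _ _ smooth_fun_const[of 1] smooth_fun_const[of "- 1"]] by simp

lemma vector_field_scale: "vector_field X \<Longrightarrow> smooth_fun f \<Longrightarrow> vector_field (\<lambda>q. f q *\<^sub>R X q)"
  using vector_field_linear_combination[OF _ _ _ smooth_fun_const[of 0], of X X f] by simp

lemma vector_field_cscale: "vector_field X \<Longrightarrow> vector_field (\<lambda>q. r *\<^sub>R X q)"
  by (intro vector_field_scale smooth_fun_const)

lemma vector_field_minus: "vector_field X \<Longrightarrow> vector_field (\<lambda>q. - X q)"
  using vector_field_cscale[of X "- 1"] by simp

end

section \<open>The Levi-Civita connection\<close>

locale levi_civita_manifold = smooth_manifold T A
  for T :: "'a topology" and A :: "('a, 'e::euclidean_space) atlas" +
  fixes g :: "'a \<Rightarrow> 'a tangent \<Rightarrow> 'a tangent \<Rightarrow> real"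
    and nabla :: "'a field \<Rightarrow> 'a field \<Rightarrow> 'a field"
  assumes riemannian: "riemannian_metric g"
    and connection: "levi_civita g nabla"
begin

lemma g_sym: "p \<in> M \<Longrightarrow> u \<in> tangent_space p \<Longrightarrow> v \<in> tangent_space p \<Longrightarrow> g p u v = g p v u"
  using riemannian[unfolded riemannian_metric_def, THEN conjunct2, THEN conjunct1] by simp

lemma g_linear_left:
  "p \<in> M \<Longrightarrow> u \<in> tangent_space p \<Longrightarrow> v \<in> tangent_space p \<Longrightarrow> w \<in> tangent_space p \<Longrightarrow>
    g p (a *\<^sub>R u + b *\<^sub>R v) w = a * g p u w + b * g p v w"
  using riemannian[unfolded riemannian_metric_def, THEN conjunct1] by simp

lemma g_linear_right:
  "p \<in> M \<Longrightarrow> u \<in> tangent_space p \<Longrightarrow> v \<in> tangent_space p \<Longrightarrow> w \<in> tangent_space p \<Longrightarrow>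
    g p w (a *\<^sub>R u + b *\<^sub>R v) = a * g p w u + b * g p w v"
  using g_linear_left[of p u v w a b] g_sym[of p w] by (simp add: tangent_intros)

lemma g_add_left: "p \<in> M \<Longrightarrow> u \<in> tangent_space p \<Longrightarrow> v \<in> tangent_space p \<Longrightarrow> w \<in> tangent_space p \<Longrightarrow>
    g p (u + v) w = g p u w + g p v w"
  using g_linear_left[of p u v w 1 1] by simp

lemma g_diff_left: "p \<in> M \<Longrightarrow> u \<in> tangent_space p \<Longrightarrow> v \<in> tangent_space p \<Longrightarrow> w \<in> tangent_space p \<Longrightarrow>
    g p (u - v) w = g p u w - g p v w"
  using g_linear_left[of p u v w 1 "- 1"] by simp

lemma g_scale_left: "p \<in> M \<Longrightarrow> u \<in> tangent_space p \<Longrightarrow> w \<in> tangent_space p \<Longrightarrow>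
    g p (a *\<^sub>R u) w = a * g p u w"
  using g_linear_left[of p u u w a 0] by simp

lemma g_minus_left: "p \<in> M \<Longrightarrow> u \<in> tangent_space p \<Longrightarrow> w \<in> tangent_space p \<Longrightarrow>
    g p (- u) w = - g p u w"
  using g_scale_left[of p u w "- 1"] by simp

lemma g_zero_left: "p \<in> M \<Longrightarrow> w \<in> tangent_space p \<Longrightarrow> g p 0 w = 0"
  using g_scale_left[of p 0 w 0] by (simp add: tangent_intros)

lemma g_add_right: "p \<in> M \<Longrightarrow> u \<in> tangent_space p \<Longrightarrow> v \<in> tangent_space p \<Longrightarrow> w \<in> tangent_space p \<Longrightarrow>
    g p w (u + v) = g p w u + g p w v"
  using g_linear_right[of p u v w 1 1] by simp

lemma g_diff_right: "p \<in> M \<Longrightarrow> u \<in> tangent_space p \<Longrightarrow> v \<in> tangent_space p \<Longrightarrow> w \<in> tangent_space p \<Longrightarrow>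
    g p w (u - v) = g p w u - g p w v"
  using g_linear_right[of p u v w 1 "- 1"] by simp

lemma g_scale_right: "p \<in> M \<Longrightarrow> u \<in> tangent_space p \<Longrightarrow> w \<in> tangent_space p \<Longrightarrow>
    g p w (a *\<^sub>R u) = a * g p w u"
  using g_linear_right[of p u u w a 0] by simp

lemma g_minus_right: "p \<in> M \<Longrightarrow> u \<in> tangent_space p \<Longrightarrow> w \<in> tangent_space p \<Longrightarrow>
    g p w (- u) = - g p w u"
  using g_scale_right[of p u w "- 1"] by simp

lemma g_zero_right: "p \<in> M \<Longrightarrow> w \<in> tangent_space p \<Longrightarrow> g p w 0 = 0"
  using g_scale_right[of p 0 w 0] by (simp add: tangent_intros)

lemmas g_simps = g_add_left g_diff_left g_scale_left g_minus_left g_zero_left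
  g_add_right g_diff_right g_scale_right g_minus_right g_zero_right

lemma g_self_pos: "p \<in> M \<Longrightarrow> u \<in> tangent_space p \<Longrightarrow> u \<noteq> 0 \<Longrightarrow> 0 < g p u u"
  using riemannian[unfolded riemannian_metric_def, THEN conjunct2, THEN conjunct2, THEN conjunct1]
  by simp

lemma g_self_eq_0D: "p \<in> M \<Longrightarrow> u \<in> tangent_space p \<Longrightarrow> g p u u = 0 \<Longrightarrow> u = 0"
  using g_self_pos[of p u] by fastforce

lemma smooth_g: "vector_field X \<Longrightarrow> vector_field Y \<Longrightarrow> smooth_fun (\<lambda>q. g q (X q) (Y q))"
  using riemannian[unfolded riemannian_metric_def ap2_def, THEN conjunct2, THEN conjunct2, THEN conjunct2]
  by simp

lemmas connection_laws = connection[unfolded levi_civita_def, THEN conjunct1, unfolded affine_connection_def]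

lemma vector_field_nabla: "vector_field X \<Longrightarrow> vector_field Y \<Longrightarrow> vector_field (nabla X Y)"
  using connection_laws[THEN conjunct1] by simp

lemma nabla_add_left: "vector_field X \<Longrightarrow> vector_field Y \<Longrightarrow> vector_field Z \<Longrightarrow> p \<in> M \<Longrightarrow>
    nabla (\<lambda>q. X q + Y q) Z p = nabla X Z p + nabla Y Z p"
  using connection_laws[THEN conjunct2, THEN conjunct1] by (simp add: plus_fun_def[of X Y, symmetric])

lemma nabla_add_right: "vector_field X \<Longrightarrow> vector_field Y \<Longrightarrow> vector_field Z \<Longrightarrow> p \<in> M \<Longrightarrow>
    nabla X (\<lambda>q. Y q + Z q) p = nabla X Y p + nabla X Z p"
  using connection_laws[THEN conjunct2, THEN conjunct1] by (simp add: plus_fun_def[of Y Z, symmetric])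

lemma nabla_scale_left: "smooth_fun f \<Longrightarrow> vector_field X \<Longrightarrow> vector_field Y \<Longrightarrow> p \<in> M \<Longrightarrow>
    nabla (\<lambda>q. f q *\<^sub>R X q) Y p = f p *\<^sub>R nabla X Y p"
  using connection_laws[THEN conjunct2, THEN conjunct2] by (simp add: fmult_def)

lemma nabla_scale_right: "smooth_fun f \<Longrightarrow> vector_field X \<Longrightarrow> vector_field Y \<Longrightarrow> p \<in> M \<Longrightarrow>
    nabla X (\<lambda>q. f q *\<^sub>R Y q) p = act X f p *\<^sub>R Y p + f p *\<^sub>R nabla X Y p"
  using connection_laws[THEN conjunct2, THEN conjunct2] by (simp add: fmult_def)

lemma nabla_minus_right: "vector_field X \<Longrightarrow> vector_field Y \<Longrightarrow> p \<in> M \<Longrightarrow>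
    nabla X (\<lambda>q. - Y q) p = - nabla X Y p"
  using nabla_scale_right[OF smooth_fun_const[of "- 1"], of X Y p] act_const[of X p "- 1"] by simp

lemma nabla_minus_left: "vector_field X \<Longrightarrow> vector_field Y \<Longrightarrow> p \<in> M \<Longrightarrow>
    nabla (\<lambda>q. - X q) Y p = - nabla X Y p"
  using nabla_scale_left[OF smooth_fun_const[of "- 1"], of X Y p] by simp

lemma nabla_diff_left: "vector_field X \<Longrightarrow> vector_field Y \<Longrightarrow> vector_field Z \<Longrightarrow> p \<in> M \<Longrightarrow>
    nabla (\<lambda>q. X q - Y q) Z p = nabla X Z p - nabla Y Z p"
  using nabla_add_left[of X "\<lambda>q. - Y q" Z p] by (simp add: nabla_minus_left vector_field_minus)

lemma nabla_diff_right: "vector_field X \<Longrightarrow> vector_field Y \<Longrightarrow> vector_field Z \<Longrightarrow> p \<in> M \<Longrightarrow>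
    nabla X (\<lambda>q. Y q - Z q) p = nabla X Y p - nabla X Z p"
  using nabla_add_right[of X Y "\<lambda>q. - Z q" p] by (simp add: nabla_minus_right vector_field_minus)

lemma act_indicator_outside:
  assumes "vector_field X" "p \<in> M"
  shows "act X (\<lambda>q. if q \<in> M then 0 else 1) p = 0"
  using act_cong[OF assms smooth_indicator_outside, of "\<lambda>q. 0"] act_const[OF assms, of 0] by simp

text \<open>The same multiplication by the function that is 0 on \<open>M\<close> and 1 elsewhere shows that the connection
  ignores the values of its arguments outside \<open>M\<close>.\<close>

lemma nabla_cong_left:
  assumes "vector_field X" "vector_field Y" "vector_field Z" "p \<in> M" "\<And>q. q \<in> M \<Longrightarrow> X q = Y q"
  shows "nabla X Z p = nabla Y Z p"
proof -
  let ?out = "\<lambda>q. if q \<in> M then 0 else 1 :: real"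
  have "X = (\<lambda>q. Y q + ?out q *\<^sub>R (X q - Y q))"
    using assms(5) by (auto simp: fun_eq_iff)
  then have "nabla X Z p = nabla (\<lambda>q. Y q + ?out q *\<^sub>R (X q - Y q)) Z p"
    by simp
  also have "\<dots> = nabla Y Z p"
    using assms(4)
    by (simp add: nabla_add_left nabla_scale_left[OF smooth_indicator_outside] vector_field_diff
        vector_field_scale[OF _ smooth_indicator_outside] assms(1-3))
  finally show ?thesis .
qed

lemma nabla_cong_right:
  assumes "vector_field X" "vector_field Y" "vector_field Z" "p \<in> M" "\<And>q. q \<in> M \<Longrightarrow> Y q = Z q"
  shows "nabla X Y p = nabla X Z p"
proof -
  let ?out = "\<lambda>q. if q \<in> M then 0 else 1 :: real"
  have "Y = (\<lambda>q. Z q + ?out q *\<^sub>R (Y q - Z q))"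
    using assms(5) by (auto simp: fun_eq_iff)
  then have "nabla X Y p = nabla X (\<lambda>q. Z q + ?out q *\<^sub>R (Y q - Z q)) p"
    by simp
  also have "\<dots> = nabla X Z p"
    using assms(4)
    by (simp add: nabla_add_right nabla_scale_right[OF smooth_indicator_outside] vector_field_diff
        vector_field_scale[OF _ smooth_indicator_outside] assms(1-3) act_indicator_outside)
  finally show ?thesis .
qed

lemma bracket_eq: "vector_field X \<Longrightarrow> vector_field Y \<Longrightarrow> p \<in> M \<Longrightarrow>
    bracket X Y p = nabla X Y p - nabla Y X p"
  using connection[unfolded levi_civita_def, THEN conjunct2, THEN conjunct1] by simp

lemma vector_field_bracket:
  assumes "vector_field X" "vector_field Y"
  shows "vector_field (bracket X Y)"
proof -
  have "vector_field (\<lambda>q. nabla X Y q - nabla Y X q)"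
    by (intro vector_field_diff vector_field_nabla assms)
  then show ?thesis
    by (subst vector_field_cong[OF bracket_eq[OF assms]])
qed

lemma nabla_bracket: "vector_field X \<Longrightarrow> vector_field Y \<Longrightarrow> vector_field Z \<Longrightarrow> p \<in> M \<Longrightarrow>
    nabla (bracket X Y) Z p = nabla (nabla X Y) Z p - nabla (nabla Y X) Z p"
  by (subst nabla_cong_left[of _ "\<lambda>q. nabla X Y q - nabla Y X q"])
    (simp_all add: bracket_eq vector_field_bracket vector_field_nabla vector_field_diff nabla_diff_left)

lemma act_g: "vector_field X \<Longrightarrow> vector_field Y \<Longrightarrow> vector_field Z \<Longrightarrow> p \<in> M \<Longrightarrow>
    act X (\<lambda>q. g q (Y q) (Z q)) p = g p (nabla X Y p) (Z p) + g p (Y p) (nabla X Z p)"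
  using connection[unfolded levi_civita_def ap2_def, THEN conjunct2, THEN conjunct2] by simp

lemma act_g_const:
  assumes "vector_field X" "vector_field Y" "vector_field Z" "p \<in> M" "\<And>q. q \<in> M \<Longrightarrow> g q (Y q) (Z q) = r"
  shows "g p (nabla X Y p) (Z p) + g p (Y p) (nabla X Z p) = 0"
  using act_g[OF assms(1-4)] act_cong[OF assms(1,4) smooth_g[OF assms(2,3)] assms(5)]
    act_const[OF assms(1,4)] by simp

end

section \<open>The shape operator of an almost cosymplectic manifold\<close>

context almost_contact_metric_manifold
begin

lemma phi_tangent: "p \<in> M \<Longrightarrow> u \<in> tangent_space p \<Longrightarrow> \<phi> p u \<in> tangent_space p"
  using phi_tensor[unfolded tensor11_field_def, THEN conjunct1] by simp

lemma phi_linear: "p \<in> M \<Longrightarrow> u \<in> tangent_space p \<Longrightarrow> v \<in> tangent_space p \<Longrightarrow>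
    \<phi> p (a *\<^sub>R u + b *\<^sub>R v) = a *\<^sub>R \<phi> p u + b *\<^sub>R \<phi> p v"
  using phi_tensor[unfolded tensor11_field_def, THEN conjunct2, THEN conjunct1] by simp

lemma vector_field_ph: "vector_field X \<Longrightarrow> vector_field (ph X)"
  using phi_tensor[unfolded tensor11_field_def, THEN conjunct2, THEN conjunct2] by simp

lemma ph_at: "ph X p = \<phi> p (X p)"
  by (simp add: ap1_def)

lemma eta_linear: "p \<in> M \<Longrightarrow> u \<in> tangent_space p \<Longrightarrow> v \<in> tangent_space p \<Longrightarrow>
    \<eta> p (a *\<^sub>R u + b *\<^sub>R v) = a * \<eta> p u + b * \<eta> p v"
  using eta_form[unfolded one_form_def, THEN conjunct1] by simp

lemma smooth_eta: "vector_field X \<Longrightarrow> smooth_fun (\<lambda>q. \<eta> q (X q))"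
  using eta_form[unfolded one_form_def ap1_def, THEN conjunct2] by simp

lemma xi_tangent: "p \<in> M \<Longrightarrow> \<xi> p \<in> tangent_space p"
  using xi_field by (rule vector_field_at)

lemma phi_add: "p \<in> M \<Longrightarrow> u \<in> tangent_space p \<Longrightarrow> v \<in> tangent_space p \<Longrightarrow>
    \<phi> p (u + v) = \<phi> p u + \<phi> p v"
  using phi_linear[of p u v 1 1] by simp

lemma phi_diff: "p \<in> M \<Longrightarrow> u \<in> tangent_space p \<Longrightarrow> v \<in> tangent_space p \<Longrightarrow>
    \<phi> p (u - v) = \<phi> p u - \<phi> p v"
  using phi_linear[of p u v 1 "- 1"] by simp

lemma phi_scale: "p \<in> M \<Longrightarrow> u \<in> tangent_space p \<Longrightarrow> \<phi> p (a *\<^sub>R u) = a *\<^sub>R \<phi> p u"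
  using phi_linear[of p u u a 0] by simp

lemma phi_minus: "p \<in> M \<Longrightarrow> u \<in> tangent_space p \<Longrightarrow> \<phi> p (- u) = - \<phi> p u"
  using phi_scale[of p u "- 1"] by simp

lemma phi_zero: "p \<in> M \<Longrightarrow> \<phi> p 0 = 0"
  using phi_scale[of p 0 0] by (simp add: tangent_intros)

lemma eta_add: "p \<in> M \<Longrightarrow> u \<in> tangent_space p \<Longrightarrow> v \<in> tangent_space p \<Longrightarrow>
    \<eta> p (u + v) = \<eta> p u + \<eta> p v"
  using eta_linear[of p u v 1 1] by simp

lemma eta_diff: "p \<in> M \<Longrightarrow> u \<in> tangent_space p \<Longrightarrow> v \<in> tangent_space p \<Longrightarrow>
    \<eta> p (u - v) = \<eta> p u - \<eta> p v"
  using eta_linear[of p u v 1 "- 1"] by simp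

lemma eta_scale: "p \<in> M \<Longrightarrow> u \<in> tangent_space p \<Longrightarrow> \<eta> p (a *\<^sub>R u) = a * \<eta> p u"
  using eta_linear[of p u u a 0] by simp

lemma eta_minus: "p \<in> M \<Longrightarrow> u \<in> tangent_space p \<Longrightarrow> \<eta> p (- u) = - \<eta> p u"
  using eta_scale[of p u "- 1"] by simp

lemma eta_zero: "p \<in> M \<Longrightarrow> \<eta> p 0 = 0"
  using eta_scale[of p 0 0] by (simp add: tangent_intros)

lemmas phi_eta_simps = phi_add phi_diff phi_scale phi_minus phi_zero
  eta_add eta_diff eta_scale eta_minus eta_zero

lemma xi_nonzero: "p \<in> M \<Longrightarrow> \<xi> p \<noteq> 0"
  using eta_xi eta_zero by fastforce

text \<open>As \<open>\<phi>\<^sup>2 \<xi> = 0\<close>, the formula for \<open>\<phi>\<^sup>2\<close> applied to \<open>\<phi> \<xi>\<close> shows that \<open>\<phi> \<xi> = c \<xi>\<close>; then \<open>0 = \<phi>\<^sup>2 \<xi> = c\<^sup>2 \<xi>\<close>.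
  The lemma after it compares the two ways of evaluating \<open>\<phi>\<^sup>3\<close>.\<close>

lemma phi_xi:
  assumes p: "p \<in> M"
  shows "\<phi> p (\<xi> p) = 0"
proof -
  let ?c = "\<eta> p (\<phi> p (\<xi> p))"
  have xi: "\<xi> p \<in> tangent_space p" "\<phi> p (\<xi> p) \<in> tangent_space p"
    using p by (auto intro: phi_tangent xi_tangent)
  have "\<phi> p (\<phi> p (\<xi> p)) = 0"
    using phi_phi[OF p xi(1)] eta_xi[OF p] by simp
  moreover from this have *: "\<phi> p (\<xi> p) = ?c *\<^sub>R \<xi> p"
    using phi_phi[OF p xi(2)] phi_zero[OF p] by (simp add: eq_neg_iff_add_eq_0[symmetric])
  moreover from * have "\<phi> p (\<phi> p (\<xi> p)) = ?c *\<^sub>R \<phi> p (\<xi> p)"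
    using phi_scale[OF p xi(1), of ?c] by simp
  ultimately show ?thesis
    using scaleR_zero_left by (metis scaleR_eq_0_iff)
qed

lemma eta_phi:
  assumes p: "p \<in> M" and u: "u \<in> tangent_space p"
  shows "\<eta> p (\<phi> p u) = 0"
proof -
  have "\<phi> p (\<phi> p (\<phi> p u)) = - \<phi> p u"
    by (subst phi_phi[OF p u]) (simp add: phi_eta_simps p u tangent_intros xi_tangent phi_xi)
  then have "\<eta> p (\<phi> p u) *\<^sub>R \<xi> p = 0"
    using phi_phi[OF p phi_tangent[OF p u]] by simp
  then show ?thesis
    using xi_nonzero[OF p] by simp
qed

end

locale almost_cosymplectic_levi_civita =
  almost_cosymplectic_manifold T A \<phi> \<xi> \<eta> g + levi_civita_manifold T A g nabla
  for T :: "'a topology" and A :: "('a, 'e::euclidean_space) atlas" and \<phi> \<xi> \<eta> g nabla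
begin

lemma g_xi_left: "p \<in> M \<Longrightarrow> u \<in> tangent_space p \<Longrightarrow> g p (\<xi> p) u = \<eta> p u"
  using phi_metric[of p "\<xi> p" u] by (simp add: phi_xi xi_tangent phi_tangent eta_xi g_zero_left)

lemma g_xi_right: "p \<in> M \<Longrightarrow> u \<in> tangent_space p \<Longrightarrow> g p u (\<xi> p) = \<eta> p u"
  using g_xi_left g_sym xi_tangent by metis

lemma phi_skew:
  assumes "p \<in> M" "u \<in> tangent_space p" "v \<in> tangent_space p"
  shows "g p (\<phi> p u) v = - g p u (\<phi> p v)"
  using phi_metric[of p u "\<phi> p v"] assms
  by (simp add: phi_phi eta_phi phi_tangent g_simps xi_tangent tangent_intros g_xi_right)

lemmas vector_field_intros = xi_field vector_field_ph vector_field_nabla vector_field_bracket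
  vector_field_add vector_field_diff vector_field_minus vector_field_cscale
  vector_field_scale

lemmas tangent_simps = vector_field_at tangent_intros phi_tangent xi_tangent

lemma act_eta: "vector_field X \<Longrightarrow> vector_field Y \<Longrightarrow> p \<in> M \<Longrightarrow>
    act X (\<lambda>q. \<eta> q (Y q)) p = \<eta> p (nabla X Y p) + g p (Y p) (nabla X \<xi> p)"
  using act_g[of X Y \<xi> p] act_cong[OF _ _ smooth_eta, of X p Y "\<lambda>q. g q (Y q) (\<xi> q)"]
  by (simp add: g_xi_right vector_field_at vector_field_nabla xi_field)

text \<open>The shape operator of the leaves of the foliation \<open>\<eta> = 0\<close>.\<close>

definition shape :: "'a field \<Rightarrow> 'a field" where
  "shape X = (\<lambda>p. - nabla X \<xi> p)"

lemma vector_field_shape: "vector_field X \<Longrightarrow> vector_field (shape X)"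
  unfolding shape_def by (intro vector_field_intros)

lemma nabla_xi: "nabla X \<xi> p = - shape X p"
  by (simp add: shape_def)

lemma eta_shape:
  assumes "vector_field X" "p \<in> M"
  shows "\<eta> p (shape X p) = 0"
proof -
  have "g p (nabla X \<xi> p) (\<xi> p) + g p (\<xi> p) (nabla X \<xi> p) = 0"
    by (rule act_g_const[OF assms(1) xi_field xi_field assms(2), of 1])
      (simp add: g_xi_right xi_tangent eta_xi)
  then show ?thesis
    using assms by (simp add: g_xi_left g_xi_right vector_field_at vector_field_nabla xi_field
        shape_def phi_eta_simps)
qed

text \<open>In \<open>d\<eta>(X,Y)\<close> the derivatives of \<open>X\<close> and \<open>Y\<close> cancel because the connection is torsion-free; what
  remains is the skew part of \<open>\<nabla>\<xi>\<close>.\<close>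

lemma shape_symmetric:
  assumes X: "vector_field X" and Y: "vector_field Y" and p: "p \<in> M"
  shows "g p (shape X p) (Y p) = g p (X p) (shape Y p)"
proof -
  have "act X (\<lambda>q. \<eta> q (Y q)) p - act Y (\<lambda>q. \<eta> q (X q)) p - \<eta> p (bracket X Y p) = 0"
    using d_eta[OF X Y p] by (simp add: ext_deriv1_def ap1_def)
  then have "g p (Y p) (shape X p) = g p (X p) (shape Y p)"
    using X Y p by (simp add: act_eta bracket_eq nabla_xi eta_diff g_simps tangent_simps
        vector_field_nabla vector_field_shape)
  then show ?thesis
    using g_sym[OF p, of "Y p" "shape X p"] X Y p by (simp add: vector_field_at vector_field_shape)
qed

lemma shape_xi:
  assumes p: "p \<in> M"
  shows "shape \<xi> p = 0"
proof -
  have "g p (shape \<xi> p) (shape \<xi> p) = 0"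
    using shape_symmetric[OF xi_field vector_field_shape[OF xi_field] p]
      eta_shape[OF vector_field_shape[OF xi_field] p] p
    by (simp add: g_xi_left vector_field_at vector_field_shape xi_field)
  then show ?thesis
    using g_self_eq_0D p by (simp add: vector_field_at vector_field_shape xi_field)
qed

text \<open>The pairing with any field can be moved to the other side by symmetry, where only the value of \<open>X\<close> at
  \<open>p\<close> enters.\<close>

lemma shape_local:
  assumes X: "vector_field X" and Y: "vector_field Y" and p: "p \<in> M" and eq: "X p = Y p"
  shows "shape X p = shape Y p"
proof -
  let ?Z = "\<lambda>q. shape X q - shape Y q"
  have Z: "vector_field ?Z"
    by (intro vector_field_diff vector_field_shape X Y)
  have "g p (?Z p) (?Z p) = g p (shape X p) (?Z p) - g p (shape Y p) (?Z p)"
    using X Y p by (simp add: g_simps tangent_simps vector_field_shape)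
  also have "\<dots> = 0"
    using shape_symmetric[OF X Z p] shape_symmetric[OF Y Z p] eq by simp
  finally show ?thesis
    using g_self_eq_0D[OF p vector_field_at[OF Z p]] by simp
qed

lemma shape_add: "vector_field X \<Longrightarrow> vector_field Y \<Longrightarrow> p \<in> M \<Longrightarrow>
    shape (\<lambda>q. X q + Y q) p = shape X p + shape Y p"
  by (simp add: shape_def nabla_add_left xi_field)

lemma shape_scale: "smooth_fun f \<Longrightarrow> vector_field X \<Longrightarrow> p \<in> M \<Longrightarrow>
    shape (\<lambda>q. f q *\<^sub>R X q) p = f p *\<^sub>R shape X p"
  by (simp add: shape_def nabla_scale_left xi_field)

lemma shape_cscale: "vector_field X \<Longrightarrow> p \<in> M \<Longrightarrow> shape (\<lambda>q. r *\<^sub>R X q) p = r *\<^sub>R shape X p"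
  by (intro shape_scale smooth_fun_const)

lemma shape_minus: "vector_field X \<Longrightarrow> p \<in> M \<Longrightarrow> shape (\<lambda>q. - X q) p = - shape X p"
  by (simp add: shape_def nabla_minus_left xi_field)

lemma shape_diff: "vector_field X \<Longrightarrow> vector_field Y \<Longrightarrow> p \<in> M \<Longrightarrow>
    shape (\<lambda>q. X q - Y q) p = shape X p - shape Y p"
  by (simp add: shape_def nabla_diff_left xi_field)

lemma shape_horizontal_part:
  assumes X: "vector_field X" and p: "p \<in> M"
  shows "shape (\<lambda>q. X q - \<eta> q (X q) *\<^sub>R \<xi> q) p = shape X p"
  by (simp add: shape_diff shape_scale[OF smooth_eta[OF X]] vector_field_scale[OF _ smooth_eta]
      X p xi_field shape_xi)

text \<open>Torsion-freeness turns the brackets into covariant derivatives, and half of the terms cancel.\<close>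

lemma fundamental_form_closed:
  assumes X: "vector_field X" and Y: "vector_field Y" and Z: "vector_field Z" and p: "p \<in> M"
  shows "g p (Y p) (nabla X (ph Z) p) + g p (nabla Y X p) (\<phi> p (Z p))
       + g p (Z p) (nabla Y (ph X) p) + g p (nabla Z Y p) (\<phi> p (X p))
       + g p (X p) (nabla Z (ph Y) p) + g p (nabla X Z p) (\<phi> p (Y p)) = 0"
proof -
  have Phi: "ap2 fundamental_form U V = (\<lambda>q. g q (U q) (ph V q))" for U V
    by (simp add: ap2_def fundamental_form_def ph_at)
  have "(g p (nabla X Y p) (ph Z p) + g p (Y p) (nabla X (ph Z) p))
      + (g p (nabla Y Z p) (ph X p) + g p (Z p) (nabla Y (ph X) p))
      + (g p (nabla Z X p) (ph Y p) + g p (X p) (nabla Z (ph Y) p))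
      - g p (bracket X Y p) (ph Z p) - g p (bracket Y Z p) (ph X p) - g p (bracket Z X p) (ph Y p) = 0"
    using d_Phi[OF X Y Z p] X Y Z p by (simp add: ext_deriv2_def Phi act_g vector_field_ph)
  then show ?thesis
    using X Y Z p by (simp add: bracket_eq ph_at g_simps tangent_simps vector_field_nabla)
qed

lemma nabla_zero_on:
  assumes "vector_field X" "vector_field Y" "p \<in> M" "\<And>q. q \<in> M \<Longrightarrow> Y q = 0"
  shows "nabla X Y p = 0"
proof -
  have "nabla X Y p = nabla X (\<lambda>q. 0 *\<^sub>R Y q) p"
    by (rule nabla_cong_right) (simp_all add: assms vector_field_cscale del: scaleR_zero_left)
  also have "\<dots> = 0"
    using nabla_scale_right[OF smooth_fun_const[of 0] assms(1-3)] act_const[OF assms(1,3)] by simp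
  finally show ?thesis .
qed

lemma eta_nabla:
  assumes "vector_field X" "vector_field Y" "p \<in> M" "\<And>q. q \<in> M \<Longrightarrow> \<eta> q (Y q) = 0"
  shows "\<eta> p (nabla X Y p) = g p (shape X p) (Y p)"
proof -
  have "g p (nabla X Y p) (\<xi> p) + g p (Y p) (nabla X \<xi> p) = 0"
    by (rule act_g_const[OF assms(1,2) xi_field assms(3), of 0])
      (simp add: g_xi_right vector_field_at assms)
  then show ?thesis
    using assms(1-3) g_sym[OF assms(3), of "shape X p" "Y p"]
    by (simp add: g_xi_right nabla_xi g_simps vector_field_at vector_field_nabla vector_field_shape)
qed

text \<open>Closedness of the fundamental form on \<open>\<xi>\<close>, \<open>X\<close>, \<open>Y\<close>, for arbitrary \<open>X\<close>: because of \<open>\<phi> \<xi> = 0\<close> only terms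
  with \<open>\<nabla>\<^bsub>\<xi>\<^esub>\<close> or with the shape operator survive.\<close>

lemma nabla_xi_ph_commutator:
  assumes Y: "vector_field Y" and p: "p \<in> M"
  shows "nabla \<xi> (ph Y) p = \<phi> p (nabla \<xi> Y p) + (shape (ph Y) p + \<phi> p (shape Y p))"
proof -
  let ?D = "\<lambda>q. nabla \<xi> (ph Y) q - (ph (nabla \<xi> Y) q + (shape (ph Y) q + ph (shape Y) q))"
  have D: "vector_field ?D"
    by (intro vector_field_intros vector_field_shape Y)
  have zero: "g p (X p) (?D p) = 0" if X: "vector_field X" for X
  proof -
    have "nabla X (ph \<xi>) p = 0"
      by (rule nabla_zero_on) (simp_all add: X p vector_field_ph xi_field ph_at phi_xi)
    moreover have "\<eta> p (nabla Y (ph X) p) = g p (shape Y p) (\<phi> p (X p))"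
      using eta_nabla[of Y "ph X" p] X Y p
      by (simp add: vector_field_ph ph_at eta_phi vector_field_at)
    moreover have "g p (shape X p) (\<phi> p (Y p)) = g p (X p) (shape (ph Y) p)"
      using shape_symmetric[OF X vector_field_ph[OF Y] p] by (simp add: ph_at)
    moreover have "g p (shape Y p) (\<phi> p (X p)) = - g p (X p) (\<phi> p (shape Y p))"
      using phi_skew[OF p, of "X p" "shape Y p"] g_sym[OF p, of "shape Y p" "\<phi> p (X p)"] X Y p
      by (simp add: tangent_simps vector_field_shape)
    moreover have "g p (nabla \<xi> Y p) (\<phi> p (X p)) = - g p (X p) (\<phi> p (nabla \<xi> Y p))"
      using phi_skew[OF p, of "X p" "nabla \<xi> Y p"] g_sym[OF p, of "nabla \<xi> Y p" "\<phi> p (X p)"] X Y p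
      by (simp add: tangent_simps vector_field_nabla xi_field)
    ultimately show ?thesis
      using fundamental_form_closed[OF xi_field X Y p] X Y p
      by (simp add: phi_xi nabla_xi g_xi_left g_simps tangent_simps vector_field_intros
          vector_field_shape ph_at)
  qed
  have "?D p = 0"
    using g_self_eq_0D[OF p vector_field_at[OF D p] zero[OF D]] .
  then show ?thesis
    by (simp add: ph_at)
qed

lemma shape_ph_ph:
  assumes Y: "vector_field Y" and p: "p \<in> M"
  shows "shape (ph (ph Y)) p = - shape Y p"
proof -
  have "shape (ph (ph Y)) p = shape (\<lambda>q. \<eta> q (Y q) *\<^sub>R \<xi> q - Y q) p"
    by (rule shape_local)
      (simp_all add: ph_at phi_phi vector_field_intros Y p vector_field_at vector_field_scale[OF _ smooth_eta])
  then show ?thesis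
    by (simp add: shape_diff shape_scale[OF smooth_eta[OF Y]] vector_field_scale[OF _ smooth_eta]
        Y p xi_field shape_xi)
qed

text \<open>By the preceding lemma, \<open>\<nabla>\<^bsub>\<xi>\<^esub>\<phi> = C\<close> for \<open>C = shape \<circ> \<phi> + \<phi> \<circ> shape\<close>. Differentiating
  \<open>\<phi>\<^sup>2 = - 1 + \<eta> \<otimes> \<xi>\<close> along \<open>\<xi>\<close> shows that \<open>C\<close> anticommutes with \<open>\<phi>\<close>, which amounts to
  \<open>\<phi> \<circ> shape \<circ> \<phi> = shape\<close>; applying \<open>\<phi>\<close> gives \<open>C = 0\<close>.\<close>

lemma shape_ph:
  assumes Y: "vector_field Y" and p: "p \<in> M"
  shows "shape (ph Y) p = - \<phi> p (shape Y p)"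
proof -
  note vf = vector_field_intros vector_field_shape vector_field_scale[OF _ smooth_eta] Y p
  have "nabla \<xi> (ph (ph Y)) p = \<phi> p (nabla \<xi> (ph Y) p) + (shape (ph (ph Y)) p + \<phi> p (shape (ph Y) p))"
    by (rule nabla_xi_ph_commutator[OF vector_field_ph[OF Y] p])
  also have "\<dots> = \<phi> p (\<phi> p (nabla \<xi> Y p)) + 2 *\<^sub>R \<phi> p (shape (ph Y) p) - 2 *\<^sub>R shape Y p"
    unfolding nabla_xi_ph_commutator[OF Y p]
    using p by (simp add: phi_eta_simps tangent_simps vf shape_ph_ph phi_phi eta_shape scaleR_2)
  also have "\<phi> p (\<phi> p (nabla \<xi> Y p)) = - nabla \<xi> Y p + \<eta> p (nabla \<xi> Y p) *\<^sub>R \<xi> p"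
    using p by (simp add: phi_phi tangent_simps vf)
  finally have 1: "nabla \<xi> (ph (ph Y)) p = - nabla \<xi> Y p + \<eta> p (nabla \<xi> Y p) *\<^sub>R \<xi> p
      + 2 *\<^sub>R \<phi> p (shape (ph Y) p) - 2 *\<^sub>R shape Y p" .
  have "nabla \<xi> (ph (ph Y)) p = nabla \<xi> (\<lambda>q. \<eta> q (Y q) *\<^sub>R \<xi> q - Y q) p"
    by (rule nabla_cong_right) (simp_all add: ph_at phi_phi vf vector_field_at)
  also have "\<dots> = - nabla \<xi> Y p + \<eta> p (nabla \<xi> Y p) *\<^sub>R \<xi> p"
    using p by (simp add: nabla_diff_right nabla_scale_right[OF smooth_eta] vf
        act_eta nabla_xi shape_xi g_zero_right vector_field_at)
  finally have "\<phi> p (shape (ph Y) p) = shape Y p"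
    using 1 by (simp add: scaleR_2[symmetric])
  then have "\<phi> p (\<phi> p (shape (ph Y) p)) = \<phi> p (shape Y p)"
    by simp
  then have "- shape (ph Y) p = \<phi> p (shape Y p)"
    using p by (simp add: phi_phi tangent_simps vf eta_shape)
  then show ?thesis
    by (metis minus_minus)
qed

lemma nabla_xi_ph:
  assumes "vector_field Y" "p \<in> M"
  shows "nabla \<xi> (ph Y) p = \<phi> p (nabla \<xi> Y p)"
  using nabla_xi_ph_commutator[OF assms] shape_ph[OF assms] by simp

lemma h_at:
  assumes X: "vector_field X" and p: "p \<in> M"
  shows "h X p = - \<phi> p (shape X p)"
proof -
  have "bracket \<xi> (ph X) p - \<phi> p (bracket \<xi> X p) = (- 2) *\<^sub>R \<phi> p (shape X p)"
    unfolding scaleR_minus_left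
    using X p by (simp add: bracket_eq vector_field_intros nabla_xi_ph nabla_xi shape_ph
        phi_eta_simps tangent_simps vector_field_shape scaleR_2)
  moreover have "h X p = (1 / 2) *\<^sub>R (bracket \<xi> (ph X) p - \<phi> p (bracket \<xi> X p))"
    by (simp add: h_def lie_deriv11_def field_scaleR_apply ap1_def)
  ultimately show ?thesis
    by simp
qed

lemma phi_h_at:
  assumes X: "vector_field X" and p: "p \<in> M"
  shows "\<phi> p (h X p) = shape X p"
  using X p by (simp add: h_at phi_eta_simps tangent_simps vector_field_shape phi_phi eta_shape)

end

context almost_cosymplectic_levi_civita
begin

definition horizontal :: "'a field \<Rightarrow> bool" where
  "horizontal X \<longleftrightarrow> vector_field X \<and> (\<forall>q\<in>M. \<eta> q (X q) = 0)"

lemma horizontal_field: "horizontal X \<Longrightarrow> vector_field X"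
  by (simp add: horizontal_def)

lemma horizontal_eta: "horizontal X \<Longrightarrow> p \<in> M \<Longrightarrow> \<eta> p (X p) = 0"
  by (simp add: horizontal_def)

lemma horizontal_bracket:
  assumes X: "horizontal X" and Y: "horizontal Y"
  shows "horizontal (bracket X Y)"
proof -
  note vf = horizontal_field[OF X] horizontal_field[OF Y]
  have "\<eta> q (bracket X Y q) = 0" if q: "q \<in> M" for q
  proof -
    have "\<eta> q (nabla X Y q) = g q (shape X q) (Y q)" "\<eta> q (nabla Y X q) = g q (shape Y q) (X q)"
      using eta_nabla X Y vf q by (auto simp: horizontal_eta)
    moreover have "g q (shape X q) (Y q) = g q (shape Y q) (X q)"
      using shape_symmetric[OF vf q] g_sym[OF q, of "shape Y q" "X q"] q vf
      by (simp add: vector_field_at vector_field_shape)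
    ultimately show ?thesis
      using vf q by (simp add: bracket_eq eta_diff vector_field_at vector_field_nabla)
  qed
  then show ?thesis
    using vf by (simp add: horizontal_def vector_field_bracket)
qed

lemma curvature_inner_nabla:
  assumes X: "vector_field X" and Y: "vector_field Y" and Z: "vector_field Z" and W: "vector_field W"
    and p: "p \<in> M"
  shows "g p (curvature nabla X Y Z p) (W p) =
    act X (\<lambda>q. g q (nabla Y Z q) (W q)) p - act Y (\<lambda>q. g q (nabla X Z q) (W q)) p
    - g p (nabla (bracket X Y) Z p) (W p)
    - g p (nabla Y Z p) (nabla X W p) + g p (nabla X Z p) (nabla Y W p)"
  using assms by (simp add: curvature_def act_g g_simps tangent_simps vector_field_intros)

end

section \<open>Eigendistributions of the shape operator of a space form\<close>

locale cosymplectic_space_form = almost_cosymplectic_levi_civita T A \<phi> \<xi> \<eta> g nabla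
  for T :: "'a topology" and A :: "('a, 'e::euclidean_space) atlas" and \<phi> \<xi> \<eta> g nabla +
  fixes f1 f2 f3 f4 f5 f6 f7 f8 :: "'a \<Rightarrow> real"
  assumes smooth_f1: "smooth_fun f1" and smooth_f3: "smooth_fun f3"
    and curvature_eq: "\<And>X Y Z p. vector_field X \<Longrightarrow> vector_field Y \<Longrightarrow> vector_field Z \<Longrightarrow> p \<in> M \<Longrightarrow>
      curvature nabla X Y Z p =
        (f1 *\<^sub>F R1 X Y Z + f2 *\<^sub>F R2 X Y Z + f3 *\<^sub>F R3 X Y Z + f4 *\<^sub>F R4 X Y Z
       + f5 *\<^sub>F R5 X Y Z + f6 *\<^sub>F R6 X Y Z + f7 *\<^sub>F R7 X Y Z + f8 *\<^sub>F R8 X Y Z) p"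
    and kappa_neg: "\<And>p. p \<in> M \<Longrightarrow> f1 p - f3 p < 0"
    and dimension: "3 < DIM('e)"
begin

lemmas R_defs = R1_def R2_def R3_def R4_def R5_def R6_def R7_def R8_def

lemma curvature_xi_xi:
  assumes X: "horizontal X" and p: "p \<in> M"
  shows "curvature nabla X \<xi> \<xi> p = (f1 p - f3 p) *\<^sub>R X p
    - (f4 p - f6 p) *\<^sub>R \<phi> p (shape X p) + (f7 p - f8 p) *\<^sub>R shape X p"
proof -
  note vf = horizontal_field[OF X] xi_field
  show ?thesis
    using p horizontal_eta[OF X p] eta_shape[OF vf(1) p]
    by (simp add: curvature_eq vf R_defs fmult_def ap2_def ap1_def field_scaleR_apply phi_h_at h_at
        shape_xi phi_xi g_xi_left g_xi_right eta_xi g_simps phi_eta_simps tangent_simps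
        vector_field_shape eta_phi phi_phi algebra_simps)
qed

lemma curvature_horizontal_xi:
  assumes X: "horizontal X" and Y: "horizontal Y" and p: "p \<in> M"
  shows "curvature nabla X Y \<xi> p = 0"
proof -
  note vf = horizontal_field[OF X] horizontal_field[OF Y] xi_field
  show ?thesis
    using p horizontal_eta[OF X p] horizontal_eta[OF Y p] eta_shape[OF vf(1) p] eta_shape[OF vf(2) p]
    by (simp add: curvature_eq vf R_defs fmult_def ap2_def ap1_def field_scaleR_apply phi_h_at h_at
        phi_xi g_xi_left g_xi_right eta_xi g_simps phi_eta_simps tangent_simps
        vector_field_shape eta_phi)
qed

text \<open>On fields tangent to the leaves the terms \<open>R3\<close>, \<open>R6\<close> and \<open>R8\<close> vanish.\<close>

lemma curvature_horizontal:
  assumes X: "horizontal X" and Y: "horizontal Y" and Z: "horizontal Z" and W: "horizontal W"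
    and p: "p \<in> M"
  shows "g p (curvature nabla X Y Z p) (W p) =
    f1 p * (g p (Y p) (Z p) * g p (X p) (W p) - g p (X p) (Z p) * g p (Y p) (W p))
  + f2 p * (g p (X p) (\<phi> p (Z p)) * g p (\<phi> p (Y p)) (W p)
          - g p (Y p) (\<phi> p (Z p)) * g p (\<phi> p (X p)) (W p)
          + 2 * (g p (X p) (\<phi> p (Y p)) * g p (\<phi> p (Z p)) (W p)))
  + f4 p * (g p (X p) (Z p) * g p (\<phi> p (shape Y p)) (W p)
          - g p (Y p) (Z p) * g p (\<phi> p (shape X p)) (W p)
          - g p (\<phi> p (shape Y p)) (Z p) * g p (X p) (W p)
          + g p (\<phi> p (shape X p)) (Z p) * g p (Y p) (W p))
  + f5 p * (g p (\<phi> p (shape Y p)) (Z p) * g p (\<phi> p (shape X p)) (W p)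
          - g p (\<phi> p (shape X p)) (Z p) * g p (\<phi> p (shape Y p)) (W p)
          + g p (shape X p) (Z p) * g p (shape Y p) (W p)
          - g p (shape Y p) (Z p) * g p (shape X p) (W p))
  + f7 p * (g p (Y p) (Z p) * g p (shape X p) (W p) - g p (X p) (Z p) * g p (shape Y p) (W p)
          + g p (shape Y p) (Z p) * g p (X p) (W p) - g p (shape X p) (Z p) * g p (Y p) (W p))"
proof -
  note vf = horizontal_field[OF X] horizontal_field[OF Y] horizontal_field[OF Z] horizontal_field[OF W]
  note eta0 = horizontal_eta[OF X p] horizontal_eta[OF Y p] horizontal_eta[OF Z p] horizontal_eta[OF W p]
  show ?thesis
    using p
    by (simp add: curvature_eq vf R_defs fmult_def ap2_def ap1_def field_scaleR_apply phi_h_at h_at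
        g_xi_left eta0 g_simps phi_eta_simps tangent_simps vector_field_shape xi_field phi_phi
        eta_shape algebra_simps)
qed

text \<open>This is \<open>R(X,\<xi>)\<xi>\<close>, the Riccati equation of the shape operator along the geodesic field \<open>\<xi>\<close>.\<close>

lemma nabla_xi_shape:
  assumes X: "horizontal X" and p: "p \<in> M"
  shows "nabla \<xi> (shape X) p - shape (nabla \<xi> X) p = shape (shape X) p + (f1 p - f3 p) *\<^sub>R X p
    - (f4 p - f6 p) *\<^sub>R \<phi> p (shape X p) + (f7 p - f8 p) *\<^sub>R shape X p"
proof -
  note vf = horizontal_field[OF X] xi_field vector_field_shape vector_field_nabla
  have xi: "nabla U \<xi> = (\<lambda>q. - shape U q)" for U
    by (simp add: fun_eq_iff nabla_xi)
  have "nabla X (nabla \<xi> \<xi>) p = 0"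
    by (rule nabla_zero_on) (simp_all add: vf p nabla_xi shape_xi)
  moreover have "nabla \<xi> (nabla X \<xi>) p = - nabla \<xi> (shape X) p"
    unfolding xi by (simp add: nabla_minus_right vf p)
  moreover have "nabla (bracket X \<xi>) \<xi> p = shape (shape X) p + shape (nabla \<xi> X) p"
    by (simp add: nabla_bracket vf p) (simp add: xi shape_minus vf p)
  ultimately show ?thesis
    using curvature_xi_xi[OF X p] by (simp add: curvature_def algebra_simps)
qed

lemma eq_0_of_symmetric_and_skew_parts:
  fixes b u :: "'v::real_vector"
  assumes "- (b + u) = b - u"
  shows "b = 0"
proof -
  have "- b = b"
    using assms by (simp add: algebra_simps)
  then have "b + b = 0"
    by (metis add.right_inverse)
  then have "2 *\<^sub>R b = 0"
    by (simp add: scaleR_2)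
  then show ?thesis
    by simp
qed

text \<open>Compare the preceding formula for \<open>X\<close> and for \<open>\<phi> X\<close>: the part \<open>shape\<^sup>2 X + \<kappa> X\<close> commutes with \<open>\<phi>\<close>,
  all other terms anticommute.\<close>

lemma shape_shape_horizontal:
  assumes X: "horizontal X" and p: "p \<in> M"
  shows "shape (shape X) p = (f3 p - f1 p) *\<^sub>R X p"
proof -
  note vf = horizontal_field[OF X] xi_field vector_field_shape vector_field_nabla vector_field_ph
  have phX: "horizontal (ph X)"
    using vf by (simp add: horizontal_def ph_at eta_phi vector_field_at)
  have phS: "vector_field (\<lambda>q. - ph (shape X) q)"
    by (intro vector_field_minus vf)
  have phS_eq: "shape (ph X) q = - ph (shape X) q" if "q \<in> M" for q
    using that by (simp add: shape_ph vf ph_at)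
  have "nabla \<xi> (shape (ph X)) p = nabla \<xi> (\<lambda>q. - ph (shape X) q) p"
    by (rule nabla_cong_right[OF _ _ phS p phS_eq]) (simp_all add: vf)
  also have "\<dots> = - \<phi> p (nabla \<xi> (shape X) p)"
    by (simp add: nabla_minus_right vf p nabla_xi_ph)
  finally have 1: "nabla \<xi> (shape (ph X)) p = - \<phi> p (nabla \<xi> (shape X) p)" .
  have "shape (nabla \<xi> (ph X)) p = shape (ph (nabla \<xi> X)) p"
    by (rule shape_local) (simp_all add: vf p nabla_xi_ph ph_at)
  also have "\<dots> = - \<phi> p (shape (nabla \<xi> X) p)"
    by (simp add: shape_ph vf p)
  finally have 2: "shape (nabla \<xi> (ph X)) p = - \<phi> p (shape (nabla \<xi> X) p)" .
  have "shape (shape (ph X)) p = shape (\<lambda>q. - ph (shape X) q) p"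
    by (rule shape_local[OF _ phS p]) (simp_all add: vf phS_eq p)
  also have "\<dots> = \<phi> p (shape (shape X) p)"
    by (simp add: shape_minus shape_ph vf p)
  finally have 3: "shape (shape (ph X)) p = \<phi> p (shape (shape X) p)" .
  let ?b = "\<phi> p (shape (shape X) p + (f1 p - f3 p) *\<^sub>R X p)"
  let ?u = "(f4 p - f6 p) *\<^sub>R shape X p + (f7 p - f8 p) *\<^sub>R \<phi> p (shape X p)"
  have "- \<phi> p (nabla \<xi> (shape X) p - shape (nabla \<xi> X) p) = ?b - ?u"
    using nabla_xi_shape[OF phX p]
    by (simp add: 1 2 3 ph_at shape_ph phi_eta_simps vf p tangent_simps phi_phi eta_shape)
  moreover have "\<phi> p (nabla \<xi> (shape X) p - shape (nabla \<xi> X) p) = ?b + ?u"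
    unfolding nabla_xi_shape[OF X p]
    by (simp add: phi_eta_simps vf p tangent_simps phi_phi eta_shape)
  ultimately have "?b = 0"
    using eq_0_of_symmetric_and_skew_parts[of ?b ?u] by simp
  then have "\<phi> p ?b = 0"
    by (simp add: phi_zero p)
  moreover have "\<phi> p (\<phi> p (shape (shape X) p + (f1 p - f3 p) *\<^sub>R X p))
      = - (shape (shape X) p + (f1 p - f3 p) *\<^sub>R X p)"
    by (subst phi_phi)
      (simp_all add: phi_eta_simps vf p tangent_simps eta_shape horizontal_eta[OF X p])
  ultimately have "- (shape (shape X) p + (f1 p - f3 p) *\<^sub>R X p) = 0"
    by (rule subst[rotated])
  then have "shape (shape X) p + (f1 p - f3 p) *\<^sub>R X p = 0"
    by (simp only: neg_equal_0_iff_equal)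
  then show ?thesis
    by (simp add: algebra_simps eq_neg_iff_add_eq_0)
qed

definition lam :: "'a \<Rightarrow> real" where
  "lam q = sqrt (f3 q - f1 q)"

lemma lam_pos: "p \<in> M \<Longrightarrow> 0 < lam p"
  using kappa_neg by (simp add: lam_def)

lemma smooth_lam: "smooth_fun lam"
  unfolding lam_def[abs_def] using kappa_neg
  by (intro smooth_fun_sqrt smooth_fun_diff smooth_f1 smooth_f3) simp

lemma shape_shape:
  assumes X: "vector_field X" and p: "p \<in> M"
  shows "shape (shape X) p = (lam p * lam p) *\<^sub>R (X p - \<eta> p (X p) *\<^sub>R \<xi> p)"
proof -
  let ?Y = "\<lambda>q. X q - \<eta> q (X q) *\<^sub>R \<xi> q"
  have Y: "horizontal ?Y"
    using X by (simp add: horizontal_def vector_field_intros vector_field_scale[OF _ smooth_eta]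
        phi_eta_simps tangent_simps eta_xi)
  have "shape (shape X) p = shape (shape ?Y) p"
    by (rule shape_local) (simp_all add: vector_field_shape X horizontal_field[OF Y] p
        shape_horizontal_part)
  also have "\<dots> = (f3 p - f1 p) *\<^sub>R ?Y p"
    by (rule shape_shape_horizontal[OF Y p])
  finally show ?thesis
    using kappa_neg[OF p] by (simp add: lam_def)
qed

definition eigen :: "real \<Rightarrow> 'a field \<Rightarrow> bool" where
  "eigen s X \<longleftrightarrow> vector_field X \<and> (\<forall>q\<in>M. shape X q = (s * lam q) *\<^sub>R X q)"

lemma eigen_field: "eigen s X \<Longrightarrow> vector_field X"
  by (simp add: eigen_def)

lemma eigen_shape: "eigen s X \<Longrightarrow> p \<in> M \<Longrightarrow> shape X p = (s * lam p) *\<^sub>R X p"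
  by (simp add: eigen_def)

lemma eigen_horizontal:
  assumes "eigen s X" "s * s = 1"
  shows "horizontal X"
proof -
  have "\<eta> q (X q) = 0" if q: "q \<in> M" for q
  proof -
    have "s * lam q * \<eta> q (X q) = 0"
      using eta_shape[OF eigen_field[OF assms(1)] q] eigen_shape[OF assms(1) q]
      by (simp add: eta_scale q vector_field_at eigen_field[OF assms(1)])
    then show ?thesis
      using lam_pos[OF q] assms(2) by auto
  qed
  then show ?thesis
    using assms(1) by (simp add: horizontal_def eigen_field)
qed

lemma eigen_ph: "eigen s X \<Longrightarrow> eigen (- s) (ph X)"
  by (simp add: eigen_def vector_field_ph shape_ph ph_at phi_scale vector_field_at)

lemma eigen_cscale: "eigen s X \<Longrightarrow> eigen s (\<lambda>q. r *\<^sub>R X q)"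
  by (simp add: eigen_def vector_field_cscale shape_cscale)

lemma eigen_minus: "eigen s X \<Longrightarrow> eigen s (\<lambda>q. - X q)"
  by (simp add: eigen_def vector_field_minus shape_minus)

lemma eigen_diff: "eigen s X \<Longrightarrow> eigen s Y \<Longrightarrow> eigen s (\<lambda>q. X q - Y q)"
  by (simp add: eigen_def vector_field_diff shape_diff scaleR_diff_right)

lemma eigen_orthogonal:
  assumes X: "eigen s X" and Y: "eigen (- s) Y" and s: "s * s = 1" and p: "p \<in> M"
  shows "g p (X p) (Y p) = 0"
proof -
  have "s * lam p * g p (X p) (Y p) = - (s * lam p * g p (X p) (Y p))"
    using shape_symmetric[OF eigen_field[OF X] eigen_field[OF Y] p]
    by (simp add: eigen_shape[OF X p] eigen_shape[OF Y p] g_simps p tangent_simps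
        eigen_field[OF X] eigen_field[OF Y])
  then show ?thesis
    using lam_pos[OF p] s by auto
qed

text \<open>Up to the factor \<open>2 lam\<close>, which is kept so as not to divide, \<open>proj s\<close> is the orthogonal projection
  onto the eigendistribution for \<open>s lam\<close>, for \<open>s = \<plusminus>1\<close>.\<close>

definition proj :: "real \<Rightarrow> 'a field \<Rightarrow> 'a field" where
  "proj s X = (\<lambda>q. lam q *\<^sub>R (X q - \<eta> q (X q) *\<^sub>R \<xi> q) + s *\<^sub>R shape X q)"

lemma eigen_proj:
  assumes X: "vector_field X" and s: "s * s = 1"
  shows "eigen s (proj s X)"
proof -
  have vf: "vector_field (\<lambda>q. X q - \<eta> q (X q) *\<^sub>R \<xi> q)"
    by (intro vector_field_intros vector_field_scale[OF _ smooth_eta] X)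
  have "vector_field (proj s X)"
    unfolding proj_def
    by (intro vector_field_add vector_field_cscale vector_field_scale[OF _ smooth_lam] vf
        vector_field_shape X)
  moreover have "shape (proj s X) q = (s * lam q) *\<^sub>R proj s X q" if q: "q \<in> M" for q
  proof -
    have "shape (proj s X) q = lam q *\<^sub>R shape X q
        + s *\<^sub>R (lam q * lam q) *\<^sub>R (X q - \<eta> q (X q) *\<^sub>R \<xi> q)"
      unfolding proj_def
      by (simp add: shape_add shape_scale[OF smooth_lam] shape_cscale vector_field_cscale
          vector_field_scale[OF _ smooth_lam] vf vector_field_shape X q shape_horizontal_part[OF X q]
          shape_shape)
    also have "\<dots> = (s * lam q) *\<^sub>R proj s X q"
    proof -
      have "(s * lam q) *\<^sub>R s *\<^sub>R shape X q = lam q *\<^sub>R shape X q"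
        using s by (simp add: mult.commute mult.left_commute)
      then show ?thesis
        by (simp add: proj_def scaleR_add_right mult.assoc)
    qed
    finally show ?thesis .
  qed
  ultimately show ?thesis
    by (simp add: eigen_def)
qed

lemma proj_sum: "(2 * lam p) *\<^sub>R X p = proj s X p + proj (- s) X p + (2 * lam p * \<eta> p (X p)) *\<^sub>R \<xi> p"
  unfolding proj_def mult_2 distrib_right scaleR_add_left by (simp add: scaleR_diff_right)

lemma g_proj:
  assumes X: "vector_field X" and W: "eigen s W" and s: "s * s = 1" and p: "p \<in> M"
  shows "g p (proj s X p) (W p) = 2 * lam p * g p (X p) (W p)"
proof -
  note vf = X eigen_field[OF W] vector_field_shape
  have "g p (shape X p) (W p) = s * lam p * g p (X p) (W p)"
    using shape_symmetric[OF X eigen_field[OF W] p] eigen_shape[OF W p]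
    by (simp add: g_simps p vector_field_at vf)
  then have "s * g p (shape X p) (W p) = lam p * g p (X p) (W p)"
    using s by (simp add: mult.assoc[symmetric])
  then show ?thesis
    using horizontal_eta[OF eigen_horizontal[OF W s] p] p
    by (simp add: proj_def g_simps tangent_simps vf g_xi_left)
qed

lemma proj_eq_0:
  assumes X: "vector_field X" and s: "s * s = 1" and p: "p \<in> M"
    and orth: "\<And>W. eigen s W \<Longrightarrow> g p (X p) (W p) = 0"
  shows "proj s X p = 0"
proof -
  note proj = eigen_proj[OF X s]
  have "g p (proj s X p) (proj s X p) = 0"
    using g_proj[OF X proj s p] orth[OF proj] by simp
  then show ?thesis
    using g_self_eq_0D p vector_field_at[OF eigen_field[OF proj]] by blast
qed

text \<open>\<open>\<phi>\<close> interchanges the two eigendistributions. So if all values of one of them at \<open>p\<close> were multiples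
  of \<open>u\<close>, then \<open>\<xi>\<close>, \<open>u\<close> and \<open>\<phi> u\<close> would span the values of all vector fields.\<close>

lemma eigen_outside_span:
  assumes p: "p \<in> M" and u: "u \<in> tangent_space p" and s: "s * s = 1"
  obtains Y where "eigen s Y" "Y p \<notin> span {u}"
proof -
  let ?S = "{\<xi> p, u, \<phi> p u}"
  have "card ?S \<le> 3"
    using card_insert_le_m1[of 3] by (simp add: card_insert_if)
  then obtain U where U: "vector_field U" "U p \<notin> span ?S"
    using vector_field_outside_span[OF p, of ?S] dimension by auto
  have s': "(- s) * (- s) = 1"
    using s by simp
  note eig = eigen_proj[OF U(1) s] eigen_proj[OF U(1) s']
  have ph_eig: "eigen s (ph (proj (- s) U))"
    using eigen_ph[OF eig(2)] by simp
  have False if 1: "proj s U p \<in> span {u}" and 2: "\<phi> p (proj (- s) U p) \<in> span {u}"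
  proof -
    obtain a b where a: "proj s U p = a *\<^sub>R u" and b: "\<phi> p (proj (- s) U p) = b *\<^sub>R u"
      using 1 2 by (auto simp: span_singleton)
    have "\<phi> p (\<phi> p (proj (- s) U p)) = - proj (- s) U p"
      using horizontal_eta[OF eigen_horizontal[OF eig(2) s'] p] p
      by (simp add: phi_phi vector_field_at eigen_field[OF eig(2)])
    then have "proj (- s) U p = (- b) *\<^sub>R \<phi> p u"
      using b phi_scale[OF p u, of b] by (metis minus_minus scaleR_minus_left)
    then have "(2 * lam p) *\<^sub>R U p = a *\<^sub>R u + (- b) *\<^sub>R \<phi> p u + (2 * lam p * \<eta> p (U p)) *\<^sub>R \<xi> p"
      using proj_sum[of p U s] a by simp
    also have "\<dots> \<in> span ?S"
      by (intro span_add span_scale span_base) auto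
    finally have "(1 / (2 * lam p)) *\<^sub>R (2 * lam p) *\<^sub>R U p \<in> span ?S"
      by (rule span_scale)
    then show False
      using U(2) lam_pos[OF p] by simp
  qed
  then show thesis
    using that[OF eig(1)] that[OF ph_eig] by (auto simp: ph_at)
qed

end

section \<open>Parallelism of the eigendistributions\<close>

context cosymplectic_space_form
begin

lemma codazzi:
  assumes X: "horizontal X" and Y: "horizontal Y" and p: "p \<in> M"
  shows "nabla X (shape Y) p - nabla Y (shape X) p = shape (nabla X Y) p - shape (nabla Y X) p"
proof -
  note vf = horizontal_field[OF X] horizontal_field[OF Y] xi_field vector_field_shape vector_field_nabla
  have xi: "nabla U \<xi> = (\<lambda>q. - shape U q)" for U
    by (simp add: fun_eq_iff nabla_xi)
  have "- nabla X (shape Y) p + nabla Y (shape X) p + (shape (nabla X Y) p - shape (nabla Y X) p) = 0"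
    using curvature_horizontal_xi[OF X Y p]
    by (simp add: curvature_def nabla_bracket vf p) (simp add: xi nabla_minus_right vf p)
  then show ?thesis
    by (simp add: algebra_simps eq_neg_iff_add_eq_0)
qed

lemma nabla_shape_eigen:
  assumes X: "vector_field X" and Y: "eigen s Y" and p: "p \<in> M"
  shows "nabla X (shape Y) p = (s * act X lam p) *\<^sub>R Y p + (s * lam p) *\<^sub>R nabla X Y p"
proof -
  note vf = X eigen_field[OF Y]
  have sl: "smooth_fun (\<lambda>q. s * lam q)"
    by (intro smooth_fun_scale smooth_lam)
  have "nabla X (shape Y) p = nabla X (\<lambda>q. (s * lam q) *\<^sub>R Y q) p"
    by (rule nabla_cong_right) (simp_all add: vf vector_field_shape vector_field_scale[OF _ sl] p
        eigen_shape[OF Y])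
  also have "\<dots> = act X (\<lambda>q. s * lam q) p *\<^sub>R Y p + (s * lam p) *\<^sub>R nabla X Y p"
    by (rule nabla_scale_right[OF sl vf p])
  also have "act X (\<lambda>q. s * lam q) p = s * act X lam p"
    using act_mult[OF X p smooth_fun_const[of s] smooth_lam] by (simp add: act_const X p)
  finally show ?thesis .
qed

lemma g_shape_eigen:
  assumes X: "vector_field X" and W: "eigen s W" and p: "p \<in> M"
  shows "g p (shape X p) (W p) = s * lam p * g p (X p) (W p)"
  using shape_symmetric[OF X eigen_field[OF W] p]
  by (simp add: eigen_shape[OF W p] g_simps p vector_field_at X eigen_field[OF W])

text \<open>The Codazzi equation for two sections \<open>X\<close>, \<open>Y\<close> of the same eigendistribution, paired with that
  distribution, reads \<open>(X lam) Y = (Y lam) X\<close>. As the distribution has rank at least two, the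
  function \<open>lam\<close> is constant along its leaves.\<close>

lemma act_lam_eigen:
  assumes X: "eigen s X" and s: "s * s = 1" and p: "p \<in> M"
  shows "act X lam p = 0"
proof (rule ccontr)
  let ?c = "act X lam p"
  assume c: "?c \<noteq> 0"
  obtain Y where Y: "eigen s Y" and out: "Y p \<notin> span {X p}"
    using eigen_outside_span[OF p vector_field_at[OF eigen_field[OF X] p] s] by blast
  let ?d = "act Y lam p"
  let ?W = "\<lambda>q. ?c *\<^sub>R Y q - ?d *\<^sub>R X q"
  have W: "eigen s ?W"
    by (intro eigen_diff eigen_cscale X Y)
  note vf = eigen_field[OF X] eigen_field[OF Y] vector_field_nabla vector_field_shape
  have "g p (nabla X (shape Y) p - nabla Y (shape X) p) (?W p)
      = g p (shape (nabla X Y) p - shape (nabla Y X) p) (?W p)"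
    using codazzi[OF eigen_horizontal[OF X s] eigen_horizontal[OF Y s] p] by simp
  moreover have Wp: "?W p \<in> tangent_space p"
    using vector_field_at[OF eigen_field[OF W] p] .
  ultimately have "s * (?c * g p (Y p) (?W p) - ?d * g p (X p) (?W p)) = 0"
    using g_shape_eigen[OF _ W p, of "nabla X Y"] g_shape_eigen[OF _ W p, of "nabla Y X"]
    unfolding nabla_shape_eigen[OF vf(1) Y p] nabla_shape_eigen[OF vf(2) X p]
    by (simp add: g_add_left[OF p] g_diff_left[OF p] g_scale_left[OF p] tangent_intros
        vector_field_at p vf algebra_simps)
  moreover have "g p (?W p) (?W p) = ?c * g p (Y p) (?W p) - ?d * g p (X p) (?W p)"
    by (simp add: g_diff_left[OF p _ _ Wp] g_scale_left[OF p _ Wp] tangent_intros vector_field_at p vf)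
  ultimately have "?W p = 0"
    using s g_self_eq_0D[OF p Wp] by auto
  then have eq: "?c *\<^sub>R Y p = ?d *\<^sub>R X p"
    by simp
  have "(1 / ?c) *\<^sub>R ?c *\<^sub>R Y p \<in> span {X p}"
    unfolding eq by (intro span_scale span_base) simp
  then show False
    using out c by simp
qed

text \<open>With \<open>lam\<close> constant along the leaves of \<open>\<eta> = 0\<close>, the Codazzi equation for \<open>X\<close> and \<open>Y\<close> in different
  eigendistributions separates into its two components.\<close>

lemma nabla_eigen_mixed:
  assumes X: "eigen s X" and Y: "eigen (- s) Y" and W: "eigen s W" and s: "s * s = 1" and p: "p \<in> M"
  shows "g p (nabla X Y p) (W p) = 0"
proof -
  note vf = eigen_field[OF X] eigen_field[OF Y] vector_field_nabla vector_field_shape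
  have s': "(- s) * (- s) = 1"
    using s by simp
  have Wp: "W p \<in> tangent_space p"
    using vector_field_at[OF eigen_field[OF W] p] .
  have "g p (nabla X (shape Y) p - nabla Y (shape X) p) (W p)
      = g p (shape (nabla X Y) p - shape (nabla Y X) p) (W p)"
    using codazzi[OF eigen_horizontal[OF X s] eigen_horizontal[OF Y s'] p] by simp
  then have "s * lam p * g p (nabla X Y p) (W p) = 0"
    using g_shape_eigen[OF _ W p, of "nabla X Y"] g_shape_eigen[OF _ W p, of "nabla Y X"]
    unfolding nabla_shape_eigen[OF vf(1) Y p] nabla_shape_eigen[OF vf(2) X p]
      act_lam_eigen[OF X s p] act_lam_eigen[OF Y s' p]
    by (simp add: g_diff_left g_scale_left g_minus_left tangent_intros vector_field_at p vf Wp)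
  then show ?thesis
    using s lam_pos[OF p] by auto
qed

text \<open>This reduces statements on \<open>\<nabla>\<^bsub>X\<^esub>\<close> to those for sections \<open>X\<close> of one eigendistribution.\<close>

lemma nabla_split:
  assumes X: "horizontal X" and Y: "vector_field Y" and s: "s * s = 1" and p: "p \<in> M"
  shows "(2 * lam p) *\<^sub>R nabla X Y p = nabla (proj s X) Y p + nabla (proj (- s) X) Y p"
proof -
  have s': "(- s) * (- s) = 1"
    using s by simp
  note vf = horizontal_field[OF X] Y
    eigen_field[OF eigen_proj[OF horizontal_field[OF X] s]]
    eigen_field[OF eigen_proj[OF horizontal_field[OF X] s']]
  have sl: "smooth_fun (\<lambda>q. 2 * lam q)"
    by (intro smooth_fun_scale smooth_lam)
  have "(2 * lam p) *\<^sub>R nabla X Y p = nabla (\<lambda>q. (2 * lam q) *\<^sub>R X q) Y p"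
    using nabla_scale_left[OF sl vf(1,2) p] by simp
  also have "\<dots> = nabla (\<lambda>q. proj s X q + proj (- s) X q) Y p"
  proof (rule nabla_cong_left[OF vector_field_scale[OF vf(1) sl] vector_field_add[OF vf(3,4)] Y p])
    show "(2 * lam q) *\<^sub>R X q = proj s X q + proj (- s) X q" if "q \<in> M" for q
      using proj_sum[of q X s] horizontal_eta[OF X that] by simp
  qed
  also have "\<dots> = nabla (proj s X) Y p + nabla (proj (- s) X) Y p"
    by (rule nabla_add_left[OF vf(3,4) Y p])
  finally show ?thesis .
qed

text \<open>The eigendistributions are parallel for the Levi-Civita connection of the leaves: for \<open>X\<close> in the
  distribution of \<open>W\<close> this is the mixed Codazzi equation; for \<open>X\<close> in that of \<open>Y\<close>, the metric moves the
  derivative from \<open>Y\<close> to \<open>W\<close>.\<close>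

lemma nabla_eigen_parallel:
  assumes X: "horizontal X" and Y: "eigen s Y" and W: "eigen (- s) W" and s: "s * s = 1" and p: "p \<in> M"
  shows "g p (nabla X Y p) (W p) = 0"
proof -
  have s': "(- s) * (- s) = 1"
    using s by simp
  note eig = eigen_proj[OF horizontal_field[OF X] s] eigen_proj[OF horizontal_field[OF X] s']
  note vf = eigen_field[OF Y] eigen_field[OF W] eigen_field[OF eig(1)] eigen_field[OF eig(2)]
  have "g p (nabla (proj s X) W p) (Y p) = 0"
    by (rule nabla_eigen_mixed[OF eig(1) W Y s p])
  moreover have "g p (nabla (proj s X) Y p) (W p) + g p (Y p) (nabla (proj s X) W p) = 0"
    by (rule act_g_const[OF vf(3,1,2) p eigen_orthogonal[OF Y W s]])
  ultimately have 1: "g p (nabla (proj s X) Y p) (W p) = 0"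
    using g_sym[OF p, of "Y p" "nabla (proj s X) W p"] by (simp add: vector_field_at vector_field_nabla vf p)
  have 2: "g p (nabla (proj (- s) X) Y p) (W p) = 0"
    using nabla_eigen_mixed[OF eig(2) _ W s' p] Y by simp
  have "2 * lam p * g p (nabla X Y p) (W p) = g p ((2 * lam p) *\<^sub>R nabla X Y p) (W p)"
    by (simp add: g_scale_left p vector_field_at vector_field_nabla vf horizontal_field[OF X])
  also have "\<dots> = 0"
    unfolding nabla_split[OF X vf(1) s p]
    using 1 2 by (simp add: g_add_left p vector_field_at vector_field_nabla vf)
  finally show ?thesis
    using lam_pos[OF p] by auto
qed

section \<open>The leaves are Kaehler manifolds\<close>

lemma nabla_ph_ph_eigen:
  assumes X: "vector_field X" and Y: "eigen s Y" and s: "s * s = 1" and p: "p \<in> M"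
  shows "nabla X (ph (ph Y)) p = - nabla X Y p"
proof -
  note vf = X eigen_field[OF Y]
  have "nabla X (ph (ph Y)) p = nabla X (\<lambda>q. - Y q) p"
    by (rule nabla_cong_right[OF X _ _ p])
      (simp_all add: vf vector_field_ph vector_field_minus ph_at phi_phi vector_field_at
        horizontal_eta[OF eigen_horizontal[OF Y s]])
  then show ?thesis
    by (simp add: nabla_minus_right vf p)
qed

lemma g_phi_phi_eigen:
  assumes Y: "eigen s Y" and W: "vector_field W" and s: "s * s = 1" and p: "p \<in> M"
  shows "g p (\<phi> p (Y p)) (\<phi> p (W p)) = g p (Y p) (W p)"
  using phi_metric[OF p vector_field_at[OF eigen_field[OF Y] p] vector_field_at[OF W p]]
    horizontal_eta[OF eigen_horizontal[OF Y s] p] by simp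

text \<open>The trilinear form \<open>b X Y W = g ((\<nabla>\<^bsub>X\<^esub> \<phi>) Y) (\<phi> W)\<close> on one eigendistribution is skew in \<open>Y\<close>
  and \<open>W\<close> because the metric is parallel, and closedness of the fundamental form makes it symmetric in
  \<open>X\<close> and \<open>W\<close>. Such a form vanishes.\<close>

lemma nabla_ph_same:
  assumes X: "eigen s X" and Y: "eigen s Y" and W: "eigen s W" and s: "s * s = 1" and p: "p \<in> M"
  shows "g p (nabla X (ph Y) p) (\<phi> p (W p)) = g p (nabla X Y p) (W p)"
proof -
  define b where "b X Y W = g p (nabla X (ph Y) p) (\<phi> p (W p)) - g p (nabla X Y p) (W p)" for X Y W
  have skew: "b X Y W = - b X W Y" if "eigen s X" "eigen s Y" "eigen s W" for X Y W
  proof -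
    note vf = that[THEN eigen_field]
    have "act X (\<lambda>q. g q (ph Y q) (ph W q)) p = act X (\<lambda>q. g q (Y q) (W q)) p"
      by (rule act_cong[OF vf(1) p smooth_g[OF vector_field_ph[OF vf(2)] vector_field_ph[OF vf(3)]]])
        (simp add: ph_at g_phi_phi_eigen[OF that(2) vf(3) s])
    then have "g p (nabla X (ph Y) p) (ph W p) + g p (ph Y p) (nabla X (ph W) p)
        = g p (nabla X Y p) (W p) + g p (Y p) (nabla X W p)"
      by (simp add: act_g vf vector_field_ph p)
    then show ?thesis
      using g_sym[OF p, of "ph Y p" "nabla X (ph W) p"] g_sym[OF p, of "Y p" "nabla X W p"]
      by (simp add: b_def vf vector_field_ph p tangent_simps vector_field_nabla ph_at)
  qed
  have sym: "b X Y W = b W Y X" if "eigen s X" "eigen s Y" "eigen s W" for X Y W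
  proof -
    note vf = that[THEN eigen_field]
    note phY = eigen_ph[OF that(2)]
    note hor = that[THEN eigen_horizontal, OF s]
    have s': "(- s) * (- s) = 1"
      using s by simp
    have hphY: "horizontal (ph Y)"
      by (rule eigen_horizontal[OF phY s'])
    have "g p (nabla (ph Y) W p) (\<phi> p (X p)) = 0"
      using nabla_eigen_parallel[OF hphY that(3) eigen_ph[OF that(1)] s p] by (simp add: ph_at)
    moreover have "g p (X p) (nabla (ph Y) (ph W) p) = 0"
      using nabla_eigen_parallel[OF hphY eigen_ph[OF that(3)] _ s' p, of X] that(1)
        g_sym[OF p, of "X p" "nabla (ph Y) (ph W) p"]
      by (simp add: vf vector_field_ph p vector_field_at vector_field_nabla)
    moreover have "\<phi> p (ph Y p) = - Y p"
      by (simp add: ph_at phi_phi p vector_field_at vf horizontal_eta[OF hor(2)])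
    ultimately have "- g p (W p) (nabla X Y p) - g p (nabla W X p) (Y p)
        + g p (\<phi> p (Y p)) (nabla W (ph X) p) + g p (nabla X (ph Y) p) (\<phi> p (W p)) = 0"
      using fundamental_form_closed[OF vf(1,3) vector_field_ph[OF vf(2)] p]
      by (simp add: nabla_ph_ph_eigen[OF vf(1) that(2) s p] g_minus_right p vector_field_at
          vector_field_nabla vf ph_at)
    then have "b X Y W + b W X Y = 0"
      using g_sym[OF p, of "W p" "nabla X Y p"] g_sym[OF p, of "ph Y p" "nabla W (ph X) p"]
      by (simp add: b_def vf vector_field_ph p tangent_simps vector_field_nabla ph_at)
    then show ?thesis
      using skew[OF that(3,1,2)] by simp
  qed
  have "b X Y W = 0"
    using skew[OF X Y W] skew[OF Y W X] skew[OF W X Y] sym[OF X Y W] sym[OF Y W X] sym[OF W X Y]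
    by simp
  then show ?thesis
    by (simp add: b_def)
qed

lemma nabla_ph_eigen:
  assumes X: "horizontal X" and Y: "eigen s Y" and W: "eigen s W" and s: "s * s = 1" and p: "p \<in> M"
  shows "g p (nabla X (ph Y) p) (\<phi> p (W p)) = g p (nabla X Y p) (W p)"
proof -
  have s': "(- s) * (- s) = 1"
    using s by simp
  note eig = eigen_proj[OF horizontal_field[OF X] s] eigen_proj[OF horizontal_field[OF X] s']
  note vf = eigen_field[OF Y] eigen_field[OF W] eigen_field[OF eig(1)] eigen_field[OF eig(2)]
    vector_field_nabla vector_field_ph horizontal_field[OF X]
  have 1: "g p (nabla (proj s X) (ph Y) p) (\<phi> p (W p)) = g p (nabla (proj s X) Y p) (W p)"
    by (rule nabla_ph_same[OF eig(1) Y W s p])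
  (* On the other eigendistribution, the preceding lemma is applied to ph Y and ph W. *)
  have 2: "g p (nabla (proj (- s) X) (ph Y) p) (\<phi> p (W p)) = g p (nabla (proj (- s) X) Y p) (W p)"
    using nabla_ph_same[OF eig(2) eigen_ph[OF Y] eigen_ph[OF W] s' p]
    by (simp add: nabla_ph_ph_eigen[OF vf(4) Y s p] ph_at phi_phi p vector_field_at vf
        horizontal_eta[OF eigen_horizontal[OF W s]] g_minus_left g_minus_right tangent_intros)
  have phW: "\<phi> p (W p) \<in> tangent_space p"
    by (simp add: phi_tangent p vector_field_at vf)
  have "2 * lam p * g p (nabla X (ph Y) p) (\<phi> p (W p)) = g p ((2 * lam p) *\<^sub>R nabla X (ph Y) p) (\<phi> p (W p))"
    by (simp add: g_scale_left p vector_field_at vf phW)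
  also have "\<dots> = g p ((2 * lam p) *\<^sub>R nabla X Y p) (W p)"
    unfolding nabla_split[OF X vf(1) s p] nabla_split[OF X vector_field_ph[OF vf(1)] s p]
    using 1 2 by (simp add: g_add_left p vector_field_at vf phW)
  also have "\<dots> = 2 * lam p * g p (nabla X Y p) (W p)"
    by (simp add: g_scale_left p vector_field_at vf)
  finally show ?thesis
    using lam_pos[OF p] by simp
qed

text \<open>Tangentially to the leaves \<open>\<phi>\<close> is parallel: \<open>(\<nabla>\<^bsub>X\<^esub> \<phi>) Y\<close> is orthogonal to one eigendistribution as these
  are parallel, and to the other one by the preceding lemma.\<close>

lemma nabla_ph:
  assumes X: "horizontal X" and Y: "eigen s Y" and s: "s * s = 1" and p: "p \<in> M"
  shows "nabla X (ph Y) p = \<phi> p (nabla X Y p) + g p (shape X p) (\<phi> p (Y p)) *\<^sub>R \<xi> p"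
proof -
  let ?D = "\<lambda>q. nabla X (ph Y) q - ph (nabla X Y) q"
  have s': "(- s) * (- s) = 1"
    using s by simp
  note vf = horizontal_field[OF X] eigen_field[OF Y] vector_field_nabla vector_field_ph vector_field_shape
  have D: "vector_field ?D"
    by (intro vector_field_diff vf)
  have "g p (?D p) (W p) = 0" if W: "eigen s W" for W
  proof -
    have "g p (nabla X (ph Y) p) (W p) = 0"
      using nabla_eigen_parallel[OF X eigen_ph[OF Y] _ s' p] W by simp
    moreover have "g p (\<phi> p (nabla X Y p)) (W p) = 0"
      using phi_skew[OF p, of "nabla X Y p" "W p"] nabla_eigen_parallel[OF X Y eigen_ph[OF W] s p]
      by (simp add: vector_field_at p vf eigen_field[OF W] ph_at)
    ultimately show ?thesis
      by (simp add: g_diff_left p vector_field_at vf eigen_field[OF W] ph_at phi_tangent)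
  qed
  then have 1: "proj s ?D p = 0"
    by (rule proj_eq_0[OF D s p])
  have "g p (?D p) (W p) = 0" if W: "eigen (- s) W" for W
  proof -
    let ?V = "\<lambda>q. - ph W q"
    have V: "eigen s ?V"
      using eigen_minus[OF eigen_ph[OF W]] by simp
    have VW: "\<phi> p (?V p) = W p"
      using horizontal_eta[OF eigen_horizontal[OF W s'] p]
      by (simp add: ph_at phi_minus phi_phi p tangent_simps eigen_field[OF W])
    have "g p (\<phi> p (nabla X Y p)) (\<phi> p (?V p)) = g p (nabla X Y p) (?V p)"
      using phi_metric[OF p, of "nabla X Y p" "?V p"] horizontal_eta[OF eigen_horizontal[OF V s] p]
        vector_field_at[OF eigen_field[OF V] p]
      by (simp add: vector_field_at p vf)
    then show ?thesis
      using nabla_ph_eigen[OF X Y V s p] unfolding VW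
      by (simp add: g_diff_left p vector_field_at vf eigen_field[OF W] ph_at phi_tangent)
  qed
  then have 2: "proj (- s) ?D p = 0"
    by (rule proj_eq_0[OF D s' p])
  have "(2 * lam p) *\<^sub>R ?D p = (2 * lam p) *\<^sub>R \<eta> p (?D p) *\<^sub>R \<xi> p"
    using proj_sum[of p ?D s] 1 2 by simp
  then have "?D p = \<eta> p (?D p) *\<^sub>R \<xi> p"
    using lam_pos[OF p] by (simp only: scaleR_cancel_left) simp
  moreover have "\<eta> p (?D p) = g p (shape X p) (\<phi> p (Y p))"
    using eta_nabla[OF vf(1) vector_field_ph[OF vf(2)] p]
    by (simp add: eta_diff p vector_field_at vf ph_at phi_tangent eta_phi)
  ultimately have "nabla X (ph Y) p - ph (nabla X Y) p = g p (shape X p) (\<phi> p (Y p)) *\<^sub>R \<xi> p"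
    by metis
  then show ?thesis
    by (simp add: diff_eq_eq add.commute ph_at[of "nabla X Y"])
qed

section \<open>Curvature along the leaves\<close>

text \<open>The parts of \<open>D\<close> and \<open>E\<close> tangent to the leaves lie in different eigendistributions.\<close>

lemma g_opposite_parts:
  assumes D: "vector_field D" and E: "vector_field E" and s: "s * s = 1" and p: "p \<in> M"
    and orthD: "\<And>W. eigen (- s) W \<Longrightarrow> g p (D p) (W p) = 0"
    and orthE: "\<And>W. eigen s W \<Longrightarrow> g p (E p) (W p) = 0"
  shows "g p (D p) (E p) = \<eta> p (D p) * \<eta> p (E p)"
proof -
  have s': "(- s) * (- s) = 1"
    using s by simp
  note eig = eigen_proj[OF D s]
  have "proj (- s) D p = 0"
    by (rule proj_eq_0[OF D s' p]) (rule orthD)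
  then have "(2 * lam p) *\<^sub>R D p = proj s D p + (2 * lam p * \<eta> p (D p)) *\<^sub>R \<xi> p"
    using proj_sum[of p D s] by simp
  then have "g p ((2 * lam p) *\<^sub>R D p) (E p)
      = g p (proj s D p + (2 * lam p * \<eta> p (D p)) *\<^sub>R \<xi> p) (E p)"
    by simp
  then have "2 * lam p * g p (D p) (E p) = g p (proj s D p) (E p) + 2 * lam p * \<eta> p (D p) * \<eta> p (E p)"
    by (simp add: g_scale_left g_add_left g_xi_left p vector_field_at D E eigen_field[OF eig]
        tangent_intros xi_tangent)
  moreover have "g p (proj s D p) (E p) = 0"
    using orthE[OF eig] g_sym[OF p, of "proj s D p" "E p"]
    by (simp add: p vector_field_at E eigen_field[OF eig])
  ultimately show ?thesis
    using lam_pos[OF p] by simp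
qed

text \<open>This is the Gauss equation of the leaves: their curvature preserves the parallel eigendistributions,
  so that only the terms of the second fundamental form are left.\<close>

lemma curvature_opposite:
  assumes X: "horizontal X" and Y: "horizontal Y" and Z: "eigen s Z" and W: "eigen (- s) W"
    and s: "s * s = 1" and p: "p \<in> M"
  shows "g p (curvature nabla X Y Z p) (W p) =
    g p (shape X p) (Z p) * g p (shape Y p) (W p) - g p (shape Y p) (Z p) * g p (shape X p) (W p)"
proof -
  have s': "(- s) * (- s) = 1"
    using s by simp
  note vf = horizontal_field[OF X] horizontal_field[OF Y] eigen_field[OF Z] eigen_field[OF W]
  have act0: "act U (\<lambda>q. g q (nabla V Z q) (W q)) p = 0" if "horizontal U" "horizontal V" for U V
  proof -
    note UV = that[THEN horizontal_field]
    have "act U (\<lambda>q. g q (nabla V Z q) (W q)) p = act U (\<lambda>q. 0) p"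
      by (rule act_cong[OF UV(1) p smooth_g[OF vector_field_nabla[OF UV(2) vf(3)] vf(4)]])
        (rule nabla_eigen_parallel[OF that(2) Z W s])
    then show ?thesis
      by (simp add: act_const UV(1) p)
  qed
  have prod: "g p (nabla U Z p) (nabla V W p) = g p (shape U p) (Z p) * g p (shape V p) (W p)"
    if U: "horizontal U" and V: "horizontal V" for U V
  proof -
    have "g p (nabla U Z p) (nabla V W p) = \<eta> p (nabla U Z p) * \<eta> p (nabla V W p)"
    proof (rule g_opposite_parts[OF _ _ s p])
      show "g p (nabla V W p) (W' p) = 0" if "eigen s W'" for W'
        using nabla_eigen_parallel[OF V W _ s' p] that by simp
    qed (use nabla_eigen_parallel[OF U Z _ s p] U V vf in \<open>auto intro: vector_field_nabla horizontal_field\<close>)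
    then show ?thesis
      using eta_nabla[of U Z p] eta_nabla[of V W p] U V vf p horizontal_eta[OF eigen_horizontal[OF Z s]]
        horizontal_eta[OF eigen_horizontal[OF W s']]
      by (simp add: horizontal_field)
  qed
  show ?thesis
    using curvature_inner_nabla[OF vf p] act0[OF X Y] act0[OF Y X] prod[OF Y X] prod[OF X Y]
      nabla_eigen_parallel[OF horizontal_bracket[OF X Y] Z W s p]
    by simp
qed

text \<open>Again the Gauss equation: the curvature of the leaves commutes with the parallel \<open>\<phi>\<close>, so that
  the difference only involves the second fundamental form.\<close>

lemma curvature_ph:
  assumes X: "horizontal X" and Y: "horizontal Y" and Z: "eigen s Z" and W: "eigen s W"
    and s: "s * s = 1" and p: "p \<in> M"
  shows "g p (curvature nabla X Y (ph Z) p) (\<phi> p (W p)) - g p (curvature nabla X Y Z p) (W p) =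
    g p (shape Y p) (Z p) * g p (shape X p) (W p)
    - g p (shape Y p) (\<phi> p (Z p)) * g p (shape X p) (\<phi> p (W p))
    - g p (shape X p) (Z p) * g p (shape Y p) (W p)
    + g p (shape X p) (\<phi> p (Z p)) * g p (shape Y p) (\<phi> p (W p))"
proof -
  note vf = horizontal_field[OF X] horizontal_field[OF Y] eigen_field[OF Z] eigen_field[OF W]
  have acts: "act U (\<lambda>q. g q (nabla V (ph Z) q) (ph W q)) p = act U (\<lambda>q. g q (nabla V Z q) (W q)) p"
    if "horizontal U" "horizontal V" for U V
  proof -
    note UV = that[THEN horizontal_field]
    show ?thesis
      by (rule act_cong[OF UV(1) p smooth_g[OF vector_field_nabla[OF UV(2) vector_field_ph[OF vf(3)]]
              vector_field_ph[OF vf(4)]]])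
        (simp add: ph_at nabla_ph_eigen[OF that(2) Z W s])
  qed
  have prod: "g p (nabla U (ph Z) p) (nabla V (ph W) p) = g p (nabla U Z p) (nabla V W p)
      - g p (shape U p) (Z p) * g p (shape V p) (W p)
      + g p (shape U p) (\<phi> p (Z p)) * g p (shape V p) (\<phi> p (W p))"
    if U: "horizontal U" and V: "horizontal V" for U V
  proof -
    note UV = horizontal_field[OF U] horizontal_field[OF V]
    have T: "nabla U Z p \<in> tangent_space p" "nabla V W p \<in> tangent_space p"
      using UV vf p by (auto intro: vector_field_at vector_field_nabla)
    have "\<eta> p (nabla U Z p) = g p (shape U p) (Z p)" "\<eta> p (nabla V W p) = g p (shape V p) (W p)"
      using eta_nabla[OF UV(1) vf(3) p] eta_nabla[OF UV(2) vf(4) p]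
        horizontal_eta[OF eigen_horizontal[OF Z s]] horizontal_eta[OF eigen_horizontal[OF W s]]
      by auto
    then show ?thesis
      unfolding nabla_ph[OF U Z s p] nabla_ph[OF V W s p]
      by (simp add: g_add_left g_add_right g_scale_left g_scale_right p T tangent_intros phi_tangent
          xi_tangent g_xi_left g_xi_right eta_phi eta_xi phi_metric eta_add eta_scale)
  qed
  have "g p (curvature nabla X Y (ph Z) p) (ph W p) - g p (curvature nabla X Y Z p) (W p) =
      g p (nabla Y Z p) (nabla X W p) - g p (nabla Y (ph Z) p) (nabla X (ph W) p)
      - g p (nabla X Z p) (nabla Y W p) + g p (nabla X (ph Z) p) (nabla Y (ph W) p)"
    using nabla_ph_eigen[OF horizontal_bracket[OF X Y] Z W s p, folded ph_at]
    by (simp add: curvature_inner_nabla[OF vf p] p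
        curvature_inner_nabla[OF vf(1,2) vector_field_ph[OF vf(3)] vector_field_ph[OF vf(4)] p]
        acts[OF X Y] acts[OF Y X])
  then show ?thesis
    unfolding prod[OF X Y] prod[OF Y X] by (simp add: ph_at)
qed

text \<open>Orthogonal sections \<open>X\<close>, \<open>Y\<close> of one eigendistribution, and \<open>\<phi> X\<close>, \<open>\<phi> Y\<close> of the other one, give five linear
  equations for \<open>f1\<close>, \<open>f2\<close>, \<open>f5\<close>, \<open>f7\<close> at a point; they have no solution unless \<open>lam = 0\<close>.\<close>

lemma carrier_empty: "M = {}"
proof (rule ccontr)
  assume "M \<noteq> {}"
  then obtain p where p: "p \<in> M"
    by blast
  obtain X where X: "eigen 1 X" and X0: "X p \<notin> span {0}"
    using eigen_outside_span[OF p subspace_0[OF subspace_tangent_space], of 1] by auto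
  obtain Y' where Y': "eigen 1 Y'" and out: "Y' p \<notin> span {X p}"
    using eigen_outside_span[OF p vector_field_at[OF eigen_field[OF X] p], of 1] by auto
  define x where "x = X p"
  have x: "x \<in> tangent_space p" "x \<noteq> 0"
    using X0 vector_field_at[OF eigen_field[OF X] p] by (auto simp: x_def span_zero)
  (* The Gram-Schmidt step at p uses a constant factor, so that Y is again a section. *)
  define c where "c = g p x (Y' p) / g p x x"
  define Y where "Y = (\<lambda>q. Y' q - c *\<^sub>R X q)"
  have Y: "eigen 1 Y"
    unfolding Y_def by (intro eigen_diff eigen_cscale X Y')
  define y where "y = Y p"
  have y: "y \<in> tangent_space p"
    using vector_field_at[OF eigen_field[OF Y] p] by (simp add: y_def)
  have "y \<noteq> 0"
    using out by (auto simp: y_def Y_def span_singleton)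
  define a where "a = g p x x"
  define b where "b = g p y y"
  have a: "0 < a" and b: "0 < b"
    using g_self_pos[OF p] x y \<open>y \<noteq> 0\<close> by (auto simp: a_def b_def)
  have xy: "g p x y = 0"
    using a x vector_field_at[OF eigen_field[OF Y'] p]
    by (simp add: y_def Y_def g_diff_right g_scale_right p tangent_intros x_def[symmetric] c_def a_def)
  then have yx: "g p y x = 0"
    using g_sym[OF p x(1) y] by simp
  have phX: "eigen (- 1) (ph X)" and phY: "eigen (- 1) (ph Y)"
    using eigen_ph X Y by auto
  have hor: "horizontal X" "horizontal Y" "horizontal (ph X)" "horizontal (ph Y)"
    using X Y phX phY by (auto intro: eigen_horizontal)
  have eta0: "\<eta> p x = 0" "\<eta> p y = 0"
    using horizontal_eta[OF hor(1) p] horizontal_eta[OF hor(2) p] by (auto simp: x_def y_def)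
  have phi2: "\<phi> p (\<phi> p x) = - x" "\<phi> p (\<phi> p y) = - y"
    using phi_phi p x y eta0 by auto
  have cross: "g p x (\<phi> p x) = 0" "g p x (\<phi> p y) = 0" "g p y (\<phi> p x) = 0" "g p y (\<phi> p y) = 0"
    using eigen_orthogonal[OF X phX _ p] eigen_orthogonal[OF X phY _ p]
      eigen_orthogonal[OF Y phX _ p] eigen_orthogonal[OF Y phY _ p]
    by (auto simp: x_def y_def ph_at)
  then have cross': "g p (\<phi> p x) x = 0" "g p (\<phi> p y) x = 0" "g p (\<phi> p x) y = 0" "g p (\<phi> p y) y = 0"
    using g_sym[OF p] phi_tangent[OF p] x y by metis+
  note at = x_def[symmetric] y_def[symmetric] a_def[symmetric] b_def[symmetric] ph_at
    eigen_shape[OF X p] eigen_shape[OF Y p] eigen_shape[OF phX p] eigen_shape[OF phY p]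
    phi_scale phi_minus phi_metric g_scale_left g_scale_right g_minus_left g_minus_right
    p x y tangent_intros phi_tangent eta0 phi2 cross cross' xy yx
  let ?k = "lam p * lam p"
  have ab: "a * b \<noteq> 0" "a * a \<noteq> 0"
    using a b by auto
  (* The component along X of R(X, ph Y) ph Y. *)
  have "(f1 p + ?k * f5 p - ?k) * (a * b) = 0"
    using curvature_horizontal[OF hor(1,4,4,1) p] curvature_opposite[OF hor(1,4) phY _ _ p, of X] X
    by (simp add: at algebra_simps)
  then have 1: "f1 p + ?k * f5 p = ?k"
    using ab by simp
  (* The component along X of R(X, ph X) ph X. *)
  have "(f1 p + 3 * f2 p - ?k) * (a * a) = 0"
    using curvature_horizontal[OF hor(1,3,3,1) p] curvature_opposite[OF hor(1,3) phX _ _ p, of X] X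
    by (simp add: at algebra_simps)
  then have 2: "f1 p + 3 * f2 p = ?k"
    using ab by simp
  (* The component along Y of R(X, ph Y) ph X. *)
  have "(?k * f5 p - f2 p) * (a * b) = 0"
    using curvature_horizontal[OF hor(1,4,3,2) p] curvature_opposite[OF hor(1,4) phX _ _ p, of Y] Y
    by (simp add: at algebra_simps)
  then have 3: "?k * f5 p = f2 p"
    using ab by simp
  (* R(X, Y) on ph Y and on Y; then the same for the other eigendistribution, where lam changes its sign. *)
  have 4: "(f2 p + 2 * (?k * f5 p) - f1 p - 2 * (lam p * f7 p) - ?k) * (a * b) = 0"
    using curvature_horizontal[OF hor(1,2,4,3) p] curvature_horizontal[OF hor(1,2,2,1) p]
      curvature_ph[OF hor(1,2) Y X _ p]
    by (simp add: at algebra_simps)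
  have 5: "(f2 p + 2 * (?k * f5 p) - f1 p + 2 * (lam p * f7 p) - ?k) * (a * b) = 0"
    using curvature_horizontal[OF hor(3,4,4,3) p] curvature_ph[OF hor(3,4) phY phX _ p]
      curvature_horizontal[OF hor(3,4) eigen_horizontal[OF eigen_ph[OF phY]] eigen_horizontal[OF eigen_ph[OF phX]] p]
    by (simp add: at algebra_simps)
  have "f2 p + 2 * (?k * f5 p) - f1 p = ?k"
    using 4 5 ab by simp
  then have "?k = 0"
    using 1 2 3 by linarith
  then show False
    using lam_pos[OF p] by simp
qed

end

theorem proposition3p15:
  fixes T :: "'a topology" and A :: "('a, 'e::euclidean_space) atlas"
  assumes "topspace T \<noteq> {}" and "DIM('e) \<ge> 5"
  shows "\<not> (\<exists>\<phi> \<xi> \<eta> g f1 f2 f3 f4 f5 f6 f7 f8.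
            almost_cosymplectic_manifold T A \<phi> \<xi> \<eta> g \<and>
            generalized_space_form T A \<phi> \<xi> \<eta> g f1 f2 f3 f4 f5 f6 f7 f8 \<and>
            (\<forall>p \<in> topspace T. f1 p - f3 p < 0))"
proof clarify
  fix \<phi> \<xi> \<eta> g f1 f2 f3 f4 f5 f6 f7 f8
  assume "almost_cosymplectic_manifold T A \<phi> \<xi> \<eta> g"
    and "generalized_space_form T A \<phi> \<xi> \<eta> g f1 f2 f3 f4 f5 f6 f7 f8"
    and neg: "\<forall>p \<in> topspace T. f1 p - f3 p < 0"
  then interpret almost_cosymplectic_manifold T A \<phi> \<xi> \<eta> g +
    space_form: generalized_space_form T A \<phi> \<xi> \<eta> g f1 f2 f3 f4 f5 f6 f7 f8
    by simp_all
  obtain nabla where "levi_civita g nabla" and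
    "\<forall>X Y Z. vector_field X \<longrightarrow> vector_field Y \<longrightarrow> vector_field Z \<longrightarrow>
       (\<forall>p\<in>M. curvature nabla X Y Z p =
         (f1 *\<^sub>F R1 X Y Z + f2 *\<^sub>F R2 X Y Z + f3 *\<^sub>F R3 X Y Z + f4 *\<^sub>F R4 X Y Z
        + f5 *\<^sub>F R5 X Y Z + f6 *\<^sub>F R6 X Y Z + f7 *\<^sub>F R7 X Y Z + f8 *\<^sub>F R8 X Y Z) p)"
    using space_form.curvature_form by (elim exE conjE)
  then interpret cosymplectic_space_form T A \<phi> \<xi> \<eta> g nabla f1 f2 f3 f4 f5 f6 f7 f8
    using metric space_form.coefficients_smooth neg assms(2) by unfold_locales auto
  show False
    using carrier_empty assms(1) by simp
qed

end
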